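(* Let $z>0$, $\beta\ge 0$, and let $\Phi:\mathbb{R}^d\to\mathbb{R}\cup\{+\infty\}$ be a measurable symmetric function that is superstable, lower regular and integrable. Let $\Gamma$ be a stationary Gibbs point process in $\mathbb{R}^d$ with pair potential $\Phi$, i.e. with Papangelou intensity $$\lambda^*(x,\gamma)=z\,e^{-\beta\sum_{y\in\gamma}\Phi(x-y)},\qquad x\in\mathbb{R}^d,\ \gamma\in\mathbf{N}.$$ Then $\Gamma$ is not hyperuniform.
   Context: Points are unmarked. $\mathbf{N}$ is the set of locally finite subsets $\gamma\subset\mathbb{R}^d$, with the $\sigma$-field generated by the counts of points in Borel sets; $\mathbf{N}_f$ is the subset of finite configurations. For bounded Borel $\Lambda$, $\gamma_\Lambda=\gamma\cap\Lambda$ and $N_\Lambda(\gamma)$ is the number of points of $\gamma$ in $\Lambda$; $|\Lambda|$ is Lebesgue measure. A point process $\Gamma$ is a probability measure on $\mathbf{N}$ (also a random configuration with that law); it is stationary if its law is invariant under translations. $\Gamma$ is a Gibbs point process with Papangelou intensity $\lambda^*$ if for all nonnegative measurable $f$, $$\int_{\mathbf{N}}\sum_{x\in\gamma}f(x,\gamma\setminus\{x\})\,\Gamma(d\gamma)=\int_{\mathbf{N}}\int_{\mathbb{R}^d} f(x,\gamma)\lambda^*(x,\gamma)\,dx\,\Gamma(d\gamma).$$ The Gibbs process is implicitly assumed to be well-defined (in particular $\lambda^*(x,\gamma)$ is well-defined for almost all $x$ and $\Gamma$-a.a. $\gamma$). For $\gamma\in\mathbf{N}_f$ put $H(\gamma)=\sum_{\{x,y\}\subset\gamma,\,x\ne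 y}\Phi(x-y)$ (sum over unordered pairs). The potential $\Phi$ is: - superstable if for any bounded $\Lambda\subset\mathbb{R}^d$ there exist constants $A>0$, $B\ge0$ such that $H(\gamma_\Lambda)\ge A N_\Lambda(\gamma)^2-BN_\Lambda(\gamma)$ for all $\gamma\in\mathbf{N}$; - lower regular if there is a positive decreasing function $\varphi:[0,\infty)\to\mathbb{R}$ with $\int_0^\infty x^{d-1}\varphi(x)\,dx<\infty$ and $\Phi(x)\ge-\varphi(|x|)$ for all $x\in\mathbb{R}^d$; - integrable if $\int_{\mathbb{R}^d}|1-e^{-\beta\Phi(y)}|\,dy<\infty$. A stationary point process $\Gamma$ is hyperuniform if $\lim \mathrm{Var}(N_\Lambda(\Gamma))/|\Lambda|=0$ along any increasing sequence of bounded Borel sets $\Lambda_1\subseteq\Lambda_2\subseteq\dots$ tending to the whole space $\mathbb{R}^d$; the variance is taken to be $+\infty$ if the second moment is infinite. *)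

theory Defs
  imports "HOL-Probability.Probability"
begin

section \<open>Configurations and point processes\<close>

definition configs :: "'a::euclidean_space set set" where
  "configs = {\<gamma>. \<forall>K. bounded K \<longrightarrow> finite (\<gamma> \<inter> K)}"

definition point_count :: "'a set \<Rightarrow> 'a set \<Rightarrow> ennreal" where
  "point_count B \<gamma> = emeasure (count_space UNIV) (\<gamma> \<inter> B)"

definition config_space :: "'a::euclidean_space set measure" where
  "config_space = sigma configs
     {point_count B -` A \<inter> configs | B A. B \<in> sets borel \<and> A \<in> sets borel}"

definition point_process :: "'a::euclidean_space set measure \<Rightarrow> bool" where
  "point_process \<Gamma> \<longleftrightarrow> prob_space \<Gamma> \<and> sets \<Gamma> = sets config_space"

definition stationary :: "'a::euclidean_space set measure \<Rightarrow> bool" where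
  "stationary \<Gamma> \<longleftrightarrow> (\<forall>v. distr \<Gamma> config_space (\<lambda>\<gamma>. (+) v ` \<gamma>) = \<Gamma>)"


section \<open>Gibbs point processes\<close>

definition has_papangelou_intensity ::
    "'a::euclidean_space set measure \<Rightarrow> ('a \<Rightarrow> 'a set \<Rightarrow> ennreal) \<Rightarrow> bool" where
  "has_papangelou_intensity \<Gamma> L \<longleftrightarrow>
     (\<forall>f \<in> borel_measurable (borel \<Otimes>\<^sub>M config_space).
        (\<integral>\<^sup>+\<gamma>. (\<integral>\<^sup>+x. f (x, \<gamma> - {x}) \<partial>count_space \<gamma>) \<partial>\<Gamma>) =
        (\<integral>\<^sup>+\<gamma>. (\<integral>\<^sup>+x. f (x, \<gamma>) * L x \<gamma> \<partial>lborel) \<partial>\<Gamma>))"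

definition exp_ereal :: "ereal \<Rightarrow> ennreal" where
  "exp_ereal u =
     (if u = \<infinity> then \<infinity> else if u = -\<infinity> then 0 else ennreal (exp (real_of_ereal u)))"

text \<open>The possibly infinite sum of \<open>\<Phi> (x - y)\<close> over \<open>y \<in> \<gamma>\<close> is the difference of the sums of the
  positive and of the negative parts (\<^const>\<open>e2ennreal\<close> sends negative arguments to 0). It has a
  meaning unless both of these are infinite.\<close>

definition pos_energy :: "('a::euclidean_space \<Rightarrow> ereal) \<Rightarrow> 'a \<Rightarrow> 'a set \<Rightarrow> ennreal" where
  "pos_energy \<Phi> x \<gamma> = (\<integral>\<^sup>+y. e2ennreal (\<Phi> (x - y)) \<partial>count_space \<gamma>)"

definition neg_energy :: "('a::euclidean_space \<Rightarrow> ereal) \<Rightarrow> 'a \<Rightarrow> 'a set \<Rightarrow> ennreal" where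
  "neg_energy \<Phi> x \<gamma> = (\<integral>\<^sup>+y. e2ennreal (- \<Phi> (x - y)) \<partial>count_space \<gamma>)"

definition local_energy_defined :: "('a::euclidean_space \<Rightarrow> ereal) \<Rightarrow> 'a \<Rightarrow> 'a set \<Rightarrow> bool" where
  "local_energy_defined \<Phi> x \<gamma> \<longleftrightarrow> pos_energy \<Phi> x \<gamma> < \<infinity> \<or> neg_energy \<Phi> x \<gamma> < \<infinity>"

definition local_energy :: "('a::euclidean_space \<Rightarrow> ereal) \<Rightarrow> 'a \<Rightarrow> 'a set \<Rightarrow> ereal" where
  "local_energy \<Phi> x \<gamma> = enn2ereal (pos_energy \<Phi> x \<gamma>) - enn2ereal (neg_energy \<Phi> x \<gamma>)"

text \<open>For \<open>\<beta> = 0\<close> the convention \<open>0 * \<infinity> = 0\<close> of \<^typ>\<open>ereal\<close> applies, so that the intensity is the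
  constant \<open>z\<close>.\<close>

definition pair_papangelou ::
    "real \<Rightarrow> real \<Rightarrow> ('a::euclidean_space \<Rightarrow> ereal) \<Rightarrow> 'a \<Rightarrow> 'a set \<Rightarrow> ennreal" where
  "pair_papangelou z \<beta> \<Phi> x \<gamma> = ennreal z * exp_ereal (- (ereal \<beta> * local_energy \<Phi> x \<gamma>))"

definition pair_gibbs ::
    "real \<Rightarrow> real \<Rightarrow> ('a::euclidean_space \<Rightarrow> ereal) \<Rightarrow> 'a set measure \<Rightarrow> bool" where
  "pair_gibbs z \<beta> \<Phi> \<Gamma> \<longleftrightarrow>
     point_process \<Gamma> \<and>
     (AE \<gamma> in \<Gamma>. AE x in lborel. local_energy_defined \<Phi> x \<gamma>) \<and>
     has_papangelou_intensity \<Gamma> (pair_papangelou z \<beta> \<Phi>)"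


section \<open>Conditions on the pair potential\<close>

definition pair_potential :: "('a::euclidean_space \<Rightarrow> ereal) \<Rightarrow> bool" where
  "pair_potential \<Phi> \<longleftrightarrow>
     \<Phi> \<in> borel_measurable borel \<and> (\<forall>x. \<Phi> x \<noteq> -\<infinity>) \<and> (\<forall>x. \<Phi> (- x) = \<Phi> x)"

text \<open>Energy of a finite configuration. Each unordered pair occurs twice in the double sum, with the
  same value since \<open>\<Phi>\<close> is symmetric.\<close>

definition energy :: "('a::euclidean_space \<Rightarrow> ereal) \<Rightarrow> 'a set \<Rightarrow> ereal" where
  "energy \<Phi> \<gamma> = (\<Sum>x\<in>\<gamma>. \<Sum>y\<in>\<gamma> - {x}. \<Phi> (x - y)) / 2"

lemma energy_insert:
  assumes \<Phi>: "pair_potential \<Phi>" and "finite \<gamma>" "x \<notin> \<gamma>"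
  shows "energy \<Phi> (insert x \<gamma>) = (\<Sum>y\<in>\<gamma>. \<Phi> (x - y)) + energy \<Phi> \<gamma>"
proof -
  let ?S = "\<Sum>y\<in>\<gamma>. \<Phi> (x - y)"
  let ?T = "\<Sum>u\<in>\<gamma>. \<Sum>y\<in>\<gamma> - {u}. \<Phi> (u - y)"
  have ninf: "sum g A \<noteq> -\<infinity>" if "finite A" "\<forall>u\<in>A. g u \<noteq> -\<infinity>" for g :: "'a \<Rightarrow> ereal" and A
    using that by (induction A rule: finite_induct) auto
  have nS: "?S \<noteq> -\<infinity>"
    using \<Phi> assms(2) by (intro ninf) (auto simp: pair_potential_def)
  have nT: "?T \<noteq> -\<infinity>"
    using \<Phi> assms(2) by (intro ninf ballI) (auto simp: pair_potential_def)
  have sym: "\<Phi> (u - x) = \<Phi> (x - u)" for u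
    using \<Phi> by (metis minus_diff_eq pair_potential_def)
  have row: "(\<Sum>y\<in>insert x \<gamma> - {u}. \<Phi> (u - y)) = \<Phi> (x - u) + (\<Sum>y\<in>\<gamma> - {u}. \<Phi> (u - y))"
    if "u \<in> \<gamma>" for u
  proof -
    have "insert x \<gamma> - {u} = insert x (\<gamma> - {u})" using that assms(3) by auto
    then show ?thesis using assms(2,3) sym by simp
  qed
  have "(\<Sum>u\<in>insert x \<gamma>. \<Sum>y\<in>insert x \<gamma> - {u}. \<Phi> (u - y)) = ?S + (?S + ?T)"
    using assms(2,3) row by (simp add: sum.distrib)
  moreover have "(?S + (?S + ?T)) / 2 = ?S + ?T / 2"
    using nS nT by (cases ?S; cases ?T) (auto simp: field_simps numeral_eq_ereal)
  ultimately show ?thesis by (simp add: energy_def)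
qed

definition superstable :: "('a::euclidean_space \<Rightarrow> ereal) \<Rightarrow> bool" where
  "superstable \<Phi> \<longleftrightarrow>
     (\<forall>\<Lambda>. bounded \<Lambda> \<longrightarrow>
       (\<exists>A > 0. \<exists>B \<ge> 0. \<forall>\<gamma> \<in> configs.
          energy \<Phi> (\<gamma> \<inter> \<Lambda>) \<ge>
            ereal (A * real (card (\<gamma> \<inter> \<Lambda>)) ^ 2 - B * real (card (\<gamma> \<inter> \<Lambda>)))))"

definition lower_regular :: "('a::euclidean_space \<Rightarrow> ereal) \<Rightarrow> bool" where
  "lower_regular \<Phi> \<longleftrightarrow>
     (\<exists>\<phi> :: real \<Rightarrow> real.
        (\<forall>r \<ge> 0. \<phi> r > 0) \<and>
        monotone_on {0..} (\<le>) (\<ge>) \<phi> \<and>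
        set_integrable lborel {0..} (\<lambda>r. r ^ (DIM('a) - 1) * \<phi> r) \<and>
        (\<forall>x. \<Phi> x \<ge> ereal (- \<phi> (norm x))))"

definition integrable_potential :: "real \<Rightarrow> ('a::euclidean_space \<Rightarrow> ereal) \<Rightarrow> bool" where
  "integrable_potential \<beta> \<Phi> \<longleftrightarrow>
     integrable lborel (\<lambda>y. \<bar>1 - enn2real (exp_ereal (- (ereal \<beta> * \<Phi> y)))\<bar>)"


section \<open>Hyperuniformity\<close>

text \<open>For bounded \<open>\<Lambda>\<close> the set \<open>\<gamma> \<inter> \<Lambda>\<close> is finite, so \<^const>\<open>card\<close> gives the number of points.\<close>

definition count_variance :: "'a::euclidean_space set measure \<Rightarrow> 'a set \<Rightarrow> ennreal" where
  "count_variance \<Gamma> \<Lambda> =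
     (if integrable \<Gamma> (\<lambda>\<gamma>. real (card (\<gamma> \<inter> \<Lambda>)) ^ 2)
      then ennreal (prob_space.variance \<Gamma> (\<lambda>\<gamma>. real (card (\<gamma> \<inter> \<Lambda>))))
      else \<infinity>)"

definition hyperuniform :: "'a::euclidean_space set measure \<Rightarrow> bool" where
  "hyperuniform \<Gamma> \<longleftrightarrow>
     (\<forall>\<Lambda> :: nat \<Rightarrow> 'a set.
        (\<forall>n. \<Lambda> n \<in> sets borel \<and> bounded (\<Lambda> n)) \<and> incseq \<Lambda> \<and> (\<Union>n. \<Lambda> n) = UNIV \<longrightarrow>
        (\<lambda>n. count_variance \<Gamma> (\<Lambda> n) / emeasure lborel (\<Lambda> n)) \<longlonglongrightarrow> 0)"

end

theory Submission
  imports Defs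
begin

text \<open>
  The variance of the number \<open>N\<close> of points in \<open>\<Lambda>\<close> is bounded below, by the Cauchy--Schwarz
  inequality, by \<open>(E[N Y])\<^sup>2 / E[Y\<^sup>2]\<close> for every centred test variable \<open>Y\<close>. It therefore suffices to
  find \<open>Y\<close> such that both \<open>E[N Y]\<close> and \<open>E[Y\<^sup>2]\<close> are of the order of the volume of \<open>\<Lambda>\<close>.

  For a bounded weight \<open>w\<close> the innovation \<open>Y = S - I\<close>, with \<open>S\<close> the sum of \<open>w(x, \<gamma> - {x})\<close> over the
  points \<open>x\<close> of \<open>\<gamma>\<close> in \<open>\<Lambda>\<close> and \<open>I\<close> the integral of \<open>w(x, \<gamma>) L(x, \<gamma>)\<close> over \<open>\<Lambda>\<close>, where \<open>L\<close> is the
  Papangelou intensity, is centred by the defining equation of \<open>L\<close>. Adding a point to \<open>\<gamma>\<close> raises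
  \<open>N\<close> by one, so the same equation gives \<open>E[N Y] = E[I]\<close>, which is a constant times the
  volume by stationarity.

  With \<open>w = 1\<close> the second moment of \<open>Y\<close> would involve the second moment of \<open>L\<close>, whose finiteness is a
  deep fact (Ruelle's estimates). The damped weight \<open>w = 1 / (1 + L)\<close> avoids it: \<open>w L \<le> 1\<close>, and since
  adding a point \<open>y\<close> multiplies \<open>L(x, \<gamma>)\<close> by the Boltzmann factor \<open>s = exp (- \<beta> \<Phi> (x - y))\<close>, the
  contribution of a pair \<open>x, y\<close> to \<open>E[Y\<^sup>2]\<close> is at most \<open>\<bar>1 - s\<bar> (2 + L(x, \<gamma>))\<close>; this is the elementary
  inequality \<open>damped_correlation_bound\<close>. Integrability of the potential makes this integrable in
  \<open>y\<close>, and only the mean of \<open>L\<close>, that is the density of points, remains. This is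
  \<open>second_moment_bound\<close>, and \<open>variance_lower_bound\<close> combines the two estimates.

  A hyperuniform process has finite second moments in large balls, hence finite density, and the
  constant in \<open>E[I]\<close> is positive: otherwise \<open>L\<close> vanishes almost surely, so there are no points at
  all, whereas the intensity at the empty configuration is \<open>z > 0\<close>.
\<close>

section \<open>Measurability on the space of configurations\<close>

lemma space_config_space: "space config_space = configs"
  unfolding config_space_def by (subst space_measure_of_conv) simp

lemma measurable_point_count [measurable]:
  assumes "B \<in> sets borel"
  shows "point_count B \<in> borel_measurable (config_space :: 'a::euclidean_space set measure)"
proof (rule measurableI)
  fix A :: "ennreal set" assume "A \<in> sets borel"
  then have "point_count B -` A \<inter> configs \<in> {point_count B -` A \<inter> configs | B A. B \<in> sets borel \<and> A \<in> sets borel}"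
    using assms by blast
  then show "point_count B -` A \<inter> space (config_space :: 'a set measure) \<in> sets config_space"
    unfolding space_config_space unfolding config_space_def
    by (subst sets_measure_of) (auto intro!: sigma_sets.Basic)
qed simp

text \<open>The counts \<open>point_count B\<close> generate the \<open>\<sigma>\<close>-field, so that a map into configurations may be tested
  on them.\<close>

lemma measurable_into_config_space:
  fixes F :: "'w \<Rightarrow> 'a::euclidean_space set"
  assumes "\<And>w. w \<in> space M \<Longrightarrow> F w \<in> configs"
    and "\<And>B. B \<in> sets borel \<Longrightarrow> (\<lambda>w. point_count B (F w)) \<in> borel_measurable M"
  shows "F \<in> M \<rightarrow>\<^sub>M config_space"
  unfolding config_space_def
proof (rule measurable_measure_of)
  fix C assume "C \<in> {point_count B -` A \<inter> configs | B A. B \<in> sets (borel :: 'a measure) \<and> A \<in> sets borel}"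
  then obtain B A where C: "C = point_count B -` A \<inter> configs" and B: "B \<in> sets (borel :: 'a measure)"
    and A: "A \<in> sets borel" by blast
  have "F -` C \<inter> space M = (\<lambda>w. point_count B (F w)) -` A \<inter> space M"
    using C assms(1) by auto
  then show "F -` C \<inter> space M \<in> sets M"
    using measurable_sets[OF assms(2)[OF B] A] by simp
qed (use assms(1) in auto)

lemma configs_finite_ball: "\<gamma> \<in> configs \<Longrightarrow> finite (\<gamma> \<inter> ball 0 r)"
  by (auto simp: configs_def)

lemma countable_config:
  fixes \<gamma> :: "'a::euclidean_space set"
  assumes "\<gamma> \<in> configs" shows "countable \<gamma>"
proof -
  have "\<gamma> = (\<Union>n. \<gamma> \<inter> ball 0 (real n))"
    by (auto simp: reals_Archimedean2)
  then show ?thesis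
    using assms by (metis countable_UN countable_finite configs_finite_ball countableI_type)
qed

lemma point_count_eq_nn_integral:
  "point_count B \<gamma> = (\<integral>\<^sup>+y. indicator B y \<partial>count_space \<gamma>)"
proof -
  have "point_count B \<gamma> = (\<integral>\<^sup>+y. indicator (\<gamma> \<inter> B) y \<partial>count_space UNIV)"
    by (simp add: point_count_def)
  also have "\<dots> = (\<integral>\<^sup>+y. indicator B y * indicator \<gamma> y \<partial>count_space UNIV)"
    by (intro nn_integral_cong) (auto split: split_indicator)
  also have "\<dots> = (\<integral>\<^sup>+y. indicator B y \<partial>count_space \<gamma>)"
    by (subst nn_integral_count_space_indicator) (auto)
  finally show ?thesis .
qed

lemma point_count_eq_card:
  "\<gamma> \<in> configs \<Longrightarrow> bounded B \<Longrightarrow> point_count B \<gamma> = ennreal (card (\<gamma> \<inter> B))"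
  by (auto simp: point_count_def configs_def ennreal_of_nat_eq_real_of_nat)

text \<open>Counting only inside a ball keeps all counts finite, which lets the class of good sets be closed
  under complements; this fails for the full count of an infinite configuration.\<close>

lemma measurable_count_ball_section:
  fixes E :: "('w \<times> 'a::euclidean_space) set"
  assumes "E \<in> sets (M \<Otimes>\<^sub>M borel)"
  shows "(\<lambda>(w, \<gamma>). \<integral>\<^sup>+y. indicator E (w, y) * indicator (ball 0 r) y \<partial>count_space \<gamma>)
    \<in> borel_measurable (M \<Otimes>\<^sub>M config_space)"
  using Int_stable_pair_measure_generator pair_measure_closed assms
  unfolding sets_pair_measure
proof (induct rule: sigma_sets_induct_disjoint)
  case (basic E)
  then obtain A B where [measurable]: "A \<in> sets M" "B \<in> sets borel" and E: "E = A \<times> B" by blast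
  have eq: "(\<integral>\<^sup>+y. indicator E (w, y) * indicator (ball 0 r) y \<partial>count_space \<gamma>)
      = indicator A w * point_count (B \<inter> ball 0 r) \<gamma>" for w \<gamma>
    unfolding E point_count_eq_nn_integral
    by (subst nn_integral_cmult[symmetric]) (auto intro!: nn_integral_cong split: split_indicator)
  show ?case unfolding eq by measurable
next
  case empty then show ?case by simp
next
  case (compl E)
  have eq: "(\<integral>\<^sup>+y. indicator (space M \<times> space borel - E) (w, y) * indicator (ball 0 r) y \<partial>count_space \<gamma>)
      = point_count (ball 0 r) \<gamma> - (\<integral>\<^sup>+y. indicator E (w, y) * indicator (ball 0 r) y \<partial>count_space \<gamma>)"
    if "w \<in> space M" "\<gamma> \<in> configs" for w \<gamma>
  proof -
    have fin: "point_count (ball 0 r) \<gamma> \<noteq> \<infinity>"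
      using that by (simp add: point_count_eq_card)
    have "(\<integral>\<^sup>+y. indicator E (w, y) * indicator (ball 0 r) y \<partial>count_space \<gamma>) \<le> point_count (ball 0 r) \<gamma>"
      unfolding point_count_eq_nn_integral by (intro nn_integral_mono) (auto split: split_indicator)
    then have "(\<integral>\<^sup>+y. indicator E (w, y) * indicator (ball 0 r) y \<partial>count_space \<gamma>) \<noteq> \<infinity>"
      using fin by (auto simp: top_unique)
    then show ?thesis
      unfolding point_count_eq_nn_integral
      by (subst nn_integral_diff[symmetric])
         (use that in \<open>auto intro!: nn_integral_cong split: split_indicator\<close>)
  qed
  have "(\<lambda>(w, \<gamma>). point_count (ball 0 r) \<gamma> -
      (\<integral>\<^sup>+y. indicator E (w, y) * indicator (ball 0 r) y \<partial>count_space \<gamma>)) \<in> borel_measurable (M \<Otimes>\<^sub>M config_space)"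
    using compl(2) unfolding split_beta' by measurable
  then show ?case
    by (rule measurable_cong[THEN iffD1, rotated]) (clarsimp simp: space_pair_measure space_config_space, simp add: eq[unfolded space_borel])
next
  case (union F)
  have "(\<integral>\<^sup>+y. indicator (\<Union>i. F i) (w, y) * indicator (ball 0 r) y \<partial>count_space \<gamma>)
      = (\<Sum>i. \<integral>\<^sup>+y. indicator (F i) (w, y) * indicator (ball 0 r) y \<partial>count_space \<gamma>)" for w \<gamma>
    by (subst nn_integral_suminf[symmetric])
       (auto simp: suminf_indicator[OF union(1), symmetric])
  with union(3) show ?case
    by (simp add: split_beta')
qed

text \<open>Sums over the points of a configuration depend measurably on the configuration and on a parameter.
  All further measurability statements reduce to this one: the local energy, and also the counts
  after adding, deleting or translating points, are such sums.\<close>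

lemma measurable_nn_integral_config:
  fixes h :: "'w \<times> 'a::euclidean_space \<Rightarrow> ennreal"
  assumes "h \<in> borel_measurable (M \<Otimes>\<^sub>M borel)"
  shows "(\<lambda>(w, \<gamma>). \<integral>\<^sup>+y. h (w, y) \<partial>count_space \<gamma>) \<in> borel_measurable (M \<Otimes>\<^sub>M config_space)"
  using assms
proof (induct rule: borel_measurable_induct)
  case (cong f g)
  have "(\<integral>\<^sup>+y. f (w, y) \<partial>count_space \<gamma>) = (\<integral>\<^sup>+y. g (w, y) \<partial>count_space \<gamma>)" if "w \<in> space M" for w \<gamma>
    using cong that by (intro nn_integral_cong) (auto simp: space_pair_measure)
  then show ?case
    using cong(4) by (subst measurable_cong) (auto simp: space_pair_measure)
next
  case (set E)
  have "(\<integral>\<^sup>+y. indicator E (w, y) \<partial>count_space \<gamma>) =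
      (SUP n. \<integral>\<^sup>+y. indicator E (w, y) * indicator (ball 0 (real n)) y \<partial>count_space \<gamma>)" for w \<gamma>
  proof -
    have "(SUP n. indicator E (w, y) * indicator (ball 0 (real n)) y) = (indicator E (w, y) :: ennreal)" for y
    proof (rule SUP_eqI)
      fix b :: ennreal assume b: "\<And>n. n \<in> UNIV \<Longrightarrow> indicator E (w, y) * indicator (ball 0 (real n)) y \<le> b"
      obtain n where "norm y < real n" using reals_Archimedean2 by blast
      then show "indicator E (w, y) \<le> b" using b[of n] by simp
    qed (auto split: split_indicator)
    then show ?thesis
      by (subst nn_integral_monotone_convergence_SUP[symmetric])
         (auto simp: incseq_def le_fun_def split: split_indicator)
  qed
  then show ?case
    using measurable_count_ball_section[OF set] by (simp add: split_beta')
next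
  case (mult u c)
  then show ?case by (simp add: nn_integral_cmult split_beta')
next
  case (add u v)
  then show ?case by (simp add: nn_integral_add split_beta')
next
  case (seq U)
  have "(\<integral>\<^sup>+y. (SUP i. U i) (w, y) \<partial>count_space \<gamma>) = (SUP i. \<integral>\<^sup>+y. U i (w, y) \<partial>count_space \<gamma>)" for w \<gamma>
    using \<open>incseq U\<close> unfolding SUP_apply
    by (subst nn_integral_monotone_convergence_SUP) (auto simp: incseq_def le_fun_def)
  with seq(3) show ?case by (simp add: split_beta')
qed

lemma measurable_nn_integral_config_compose [measurable (raw)]:
  fixes h :: "'w \<Rightarrow> 'a::euclidean_space \<Rightarrow> ennreal"
  assumes h: "(\<lambda>(w, y). h w y) \<in> borel_measurable (M \<Otimes>\<^sub>M borel)" and g: "g \<in> M \<rightarrow>\<^sub>M config_space"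
  shows "(\<lambda>w. \<integral>\<^sup>+y. h w y \<partial>count_space (g w)) \<in> borel_measurable M"
proof -
  have "(\<lambda>w. (w, g w)) \<in> M \<rightarrow>\<^sub>M M \<Otimes>\<^sub>M config_space" using g by measurable
  from measurable_compose[OF this measurable_nn_integral_config[OF h]] show ?thesis by simp
qed

lemma configs_Diff: "\<gamma> \<in> configs \<Longrightarrow> \<gamma> - A \<in> configs"
  unfolding configs_def by (auto intro: finite_subset[of "(\<gamma> - A) \<inter> K" "\<gamma> \<inter> K" for K])

lemma configs_insert: "\<gamma> \<in> configs \<Longrightarrow> insert x \<gamma> \<in> configs"
  unfolding configs_def by (auto simp: Int_insert_left)

lemma configs_translate:
  fixes v :: "'a::euclidean_space"
  assumes "\<gamma> \<in> configs" shows "(+) v ` \<gamma> \<in> configs"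
  unfolding configs_def
proof safe
  fix K :: "'a set" assume "bounded K"
  then have "bounded ((+) (- v) ` K)" by (rule bounded_translation)
  then have "finite (\<gamma> \<inter> (+) (- v) ` K)" using assms by (auto simp: configs_def)
  moreover have "(+) v ` \<gamma> \<inter> K \<subseteq> (+) v ` (\<gamma> \<inter> (+) (- v) ` K)"
    by (force intro: image_eqI[where x = "v + x" for x])
  ultimately show "finite ((+) v ` \<gamma> \<inter> K)" by (meson finite_imageI finite_subset)
qed

lemma count_integral_Diff_singleton:
  "(\<integral>\<^sup>+y. f y \<partial>count_space (\<gamma> - {x})) = (\<integral>\<^sup>+y. f y * indicator (- {x}) y \<partial>count_space \<gamma>)"
proof -
  have "(\<integral>\<^sup>+y. f y \<partial>count_space (\<gamma> - {x})) = (\<integral>\<^sup>+y. f y * indicator (\<gamma> - {x}) y \<partial>count_space UNIV)"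
    by (simp add: nn_integral_count_space_indicator)
  also have "\<dots> = (\<integral>\<^sup>+y. (f y * indicator (- {x}) y) * indicator \<gamma> y \<partial>count_space UNIV)"
    by (intro nn_integral_cong) (auto split: split_indicator)
  finally show ?thesis
    by (simp add: nn_integral_count_space_indicator)
qed

lemma count_integral_split:
  assumes "x \<in> \<gamma>"
  shows "(\<integral>\<^sup>+y. f y \<partial>count_space \<gamma>) = f x + (\<integral>\<^sup>+y. f y \<partial>count_space (\<gamma> - {x}))"
proof -
  have "(\<integral>\<^sup>+y. f y \<partial>count_space \<gamma>)
      = (\<integral>\<^sup>+y. f y * indicator {x} y + f y * indicator (- {x}) y \<partial>count_space \<gamma>)"
    by (intro nn_integral_cong) (auto split: split_indicator)
  also have "\<dots> = (\<integral>\<^sup>+y. f y * indicator {x} y \<partial>count_space \<gamma>) + (\<integral>\<^sup>+y. f y * indicator (- {x}) y \<partial>count_space \<gamma>)"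
    by (intro nn_integral_add) auto
  also have "(\<integral>\<^sup>+y. f y * indicator {x} y \<partial>count_space \<gamma>) = f x"
    using assms by (subst nn_integral_indicator_singleton) auto
  finally show ?thesis by (simp add: count_integral_Diff_singleton)
qed

lemma count_integral_insert:
  assumes "x \<notin> \<gamma>"
  shows "(\<integral>\<^sup>+y. f y \<partial>count_space (insert x \<gamma>)) = f x + (\<integral>\<^sup>+y. f y \<partial>count_space \<gamma>)"
  using count_integral_split[of x "insert x \<gamma>" f] assms by simp

lemma measurable_remove_point [measurable]:
  "(\<lambda>(x, \<gamma>). \<gamma> - {x}) \<in> borel \<Otimes>\<^sub>M config_space \<rightarrow>\<^sub>M (config_space :: 'a::euclidean_space set measure)"
proof (rule measurable_into_config_space)
  fix B :: "'a set" assume [measurable]: "B \<in> sets borel"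
  have eq: "indicator (- {x}) y = (if x = y then 0 else 1 :: ennreal)" for x y :: 'a
    by (auto split: split_indicator)
  show "(\<lambda>w. point_count B (case w of (x, \<gamma>) \<Rightarrow> \<gamma> - {x})) \<in> borel_measurable (borel \<Otimes>\<^sub>M config_space)"
    unfolding split_beta' point_count_eq_nn_integral count_integral_Diff_singleton eq by measurable
qed (auto simp: space_pair_measure space_config_space configs_Diff)

lemma measurable_add_point [measurable]:
  "(\<lambda>(x, \<gamma>). insert x \<gamma>) \<in> borel \<Otimes>\<^sub>M config_space \<rightarrow>\<^sub>M (config_space :: 'a::euclidean_space set measure)"
proof (rule measurable_into_config_space)
  fix B :: "'a set" assume [measurable]: "B \<in> sets borel"
  have "point_count B (insert x \<gamma>) = indicator B x + point_count B (\<gamma> - {x})" for x :: 'a and \<gamma>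
    unfolding point_count_eq_nn_integral by (subst count_integral_split[of x]) auto
  then show "(\<lambda>w. point_count B (case w of (x, \<gamma>) \<Rightarrow> insert x \<gamma>)) \<in> borel_measurable (borel \<Otimes>\<^sub>M config_space)"
    unfolding split_beta' by simp
qed (auto simp: space_pair_measure space_config_space configs_insert)

lemma count_integral_translate:
  fixes v :: "'a::euclidean_space"
  shows "(\<integral>\<^sup>+y. f y \<partial>count_space ((+) v ` \<gamma>)) = (\<integral>\<^sup>+y. f (v + y) \<partial>count_space \<gamma>)"
  by (rule nn_integral_bij_count_space[symmetric]) (auto simp: bij_betw_def)

lemma measurable_translate [measurable]:
  "(\<lambda>\<gamma>. (+) v ` \<gamma>) \<in> config_space \<rightarrow>\<^sub>M (config_space :: 'a::euclidean_space set measure)"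
proof (rule measurable_into_config_space)
  fix B :: "'a set" assume [measurable]: "B \<in> sets borel"
  show "(\<lambda>\<gamma>. point_count B ((+) v ` \<gamma>)) \<in> borel_measurable config_space"
    unfolding point_count_eq_nn_integral count_integral_translate by measurable
qed (auto simp: space_config_space configs_translate)

section \<open>The damping function\<close>

definition damping :: "ennreal \<Rightarrow> ennreal" where
  "damping a = inverse (1 + a)"

definition damped :: "ennreal \<Rightarrow> ennreal" where
  "damped a = a * damping a"

lemma measurable_damping [measurable]: "damping \<in> borel_measurable borel"
  unfolding damping_def by measurable

lemma measurable_damped [measurable]: "damped \<in> borel_measurable borel"
  unfolding damped_def by measurable

lemma damping_top [simp]: "damping top = 0" and damped_top [simp]: "damped top = 0"
  by (simp_all add: damping_def damped_def)

lemma damping_ennreal: "0 \<le> a \<Longrightarrow> damping (ennreal a) = ennreal (1 / (1 + a))"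
  unfolding damping_def ennreal_1[symmetric]
  by (subst ennreal_plus[symmetric]) (auto simp: inverse_ennreal inverse_eq_divide simp del: ennreal_1 ennreal_plus)

lemma damped_ennreal: "0 \<le> a \<Longrightarrow> damped (ennreal a) = ennreal (a / (1 + a))"
  unfolding damped_def by (simp add: damping_ennreal ennreal_mult[symmetric])

lemma damping_le_1: "damping a \<le> 1"
  by (cases a) (auto simp: damping_ennreal)

lemma damped_le_1: "damped a \<le> 1"
  by (cases a) (auto simp: damped_ennreal)

lemma damped_eq_0_iff: "a \<noteq> \<infinity> \<Longrightarrow> damped a = 0 \<longleftrightarrow> a = 0"
  by (cases a) (auto simp: damped_ennreal ennreal_eq_0_iff divide_le_0_iff)

text \<open>Here \<open>a\<close>, \<open>b\<close> are the intensities at two places and \<open>s\<close> is their Boltzmann factor. With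
  \<open>u t = t / (1 + t)\<close> the difference of the two sides without the error term is
  \<open>(u (a s) - u a) (u (b s) - u b) + u (a s) u (b s) (1 / s - 1)\<close>. The function \<open>u\<close> is bounded by 1 and
  varies by at most \<open>\<bar>1 - s\<bar>\<close> when its argument is multiplied by \<open>s\<close>, which bounds the first summand.
  The second is positive only for \<open>s \<le> 1\<close>, and there \<open>u (a s) / s \<le> a\<close>.\<close>

lemma damped_correlation_bound_real:
  fixes a b s :: real
  assumes a: "0 \<le> a" and b: "0 \<le> b" and s: "0 \<le> s"
  shows "a * s / (1 + a * s) * (b / (1 + b * s)) + a / (1 + a) * (b / (1 + b))
    \<le> a / (1 + a) * (b * s / (1 + b * s)) + b / (1 + b) * (a * s / (1 + a * s)) + \<bar>1 - s\<bar> * (2 + a)"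
proof -
  have pos: "0 < 1 + a" "0 < 1 + b" "0 < 1 + a * s" "0 < 1 + b * s"
    using assms by (auto intro: add_pos_nonneg)
  define ua ub us vs w where "ua = a / (1 + a)" and "ub = b / (1 + b)"
    and "us = a * s / (1 + a * s)" and "vs = b * s / (1 + b * s)" and "w = b / (1 + b * s)"
  have bounds: "0 \<le> ua" "ua \<le> 1" "0 \<le> ub" "ub \<le> 1" "0 \<le> us" "us \<le> 1" "0 \<le> vs" "vs \<le> 1"
    using assms pos by (auto simp: ua_def ub_def us_def vs_def)
  have diff: "us - ua = a * (s - 1) / ((1 + a) * (1 + a * s))"
    using pos unfolding us_def ua_def by (simp add: divide_simps) (simp add: algebra_simps)
  have cross: "us * w = us * vs + us * w * (1 - s)"
    using pos unfolding us_def vs_def w_def by (simp add: divide_simps) (simp add: algebra_simps)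
  have first: "(us - ua) * (vs - ub) \<le> \<bar>1 - s\<bar>"
  proof -
    have "\<bar>us - ua\<bar> \<le> \<bar>1 - s\<bar>"
    proof -
      have "a \<le> (1 + a) * (1 + a * s)" using a s by (simp add: algebra_simps)
      then have "a * \<bar>s - 1\<bar> \<le> ((1 + a) * (1 + a * s)) * \<bar>s - 1\<bar>"
        by (intro mult_right_mono) auto
      then show ?thesis
        using pos a unfolding diff by (simp add: abs_mult pos_divide_le_eq abs_minus_commute mult.commute)
    qed
    moreover have "\<bar>vs - ub\<bar> \<le> 1" using bounds by auto
    ultimately have "\<bar>us - ua\<bar> * \<bar>vs - ub\<bar> \<le> \<bar>1 - s\<bar> * 1" by (intro mult_mono) auto
    then show ?thesis by (simp add: abs_mult[symmetric] abs_le_iff)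
  qed
  have second: "us * w * (1 - s) \<le> \<bar>1 - s\<bar> * (1 + a)"
  proof (cases "s \<le> 1")
    case True
    have "us * w = (a / (1 + a * s)) * vs" unfolding us_def vs_def w_def by simp
    also have "\<dots> \<le> a * 1"
      using a s bounds by (intro mult_mono) (auto simp: pos_divide_le_eq[OF pos(3)] algebra_simps)
    finally have "us * w * (1 - s) \<le> (1 + a) * (1 - s)"
      using True by (intro mult_right_mono) auto
    then show ?thesis using True by (simp add: mult.commute)
  next
    case False
    then have "us * w * (1 - s) \<le> 0"
      using bounds b pos by (intro mult_nonneg_nonpos) (auto simp: w_def)
    also have "0 \<le> \<bar>1 - s\<bar> * (1 + a)" using a by simp
    finally show ?thesis .
  qed
  have "us * w \<le> us * vs + \<bar>1 - s\<bar> * (1 + a)" using second cross by linarith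
  then show ?thesis
    using first
    unfolding ua_def[symmetric] ub_def[symmetric] us_def[symmetric] vs_def[symmetric] w_def[symmetric]
    by (simp add: algebra_simps)
qed

text \<open>The extension to infinite intensities spares the proofs below from exceptional sets. It holds because
  \<open>damped\<close> vanishes at infinity by the convention \<open>\<infinity> * 0 = 0\<close>.\<close>

lemma damped_correlation_bound:
  fixes a b :: ennreal
  assumes s: "0 \<le> s"
  shows "damped (a * ennreal s) * (damping (b * ennreal s) * b) + damped a * damped b
    \<le> damped a * damped (b * ennreal s) + damped b * damped (a * ennreal s) + ennreal \<bar>1 - s\<bar> * (2 + a)"
proof (cases a)
  case (real a')
  note a = this
  show ?thesis
  proof (cases b)
    case (real b')
    have two: "(2::ennreal) = ennreal 2" by simp
    have "ennreal (a' * s / (1 + a' * s) * (b' / (1 + b' * s)) + a' / (1 + a') * (b' / (1 + b')))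
      \<le> ennreal (a' / (1 + a') * (b' * s / (1 + b' * s)) + b' / (1 + b') * (a' * s / (1 + a' * s)) + \<bar>1 - s\<bar> * (2 + a'))"
      using a real s by (intro ennreal_leI damped_correlation_bound_real) auto
    then show ?thesis
      using a real s unfolding two
      by (simp add: ennreal_mult[symmetric] ennreal_plus[symmetric] damped_ennreal damping_ennreal
          del: ennreal_plus ennreal_numeral)
  next
    case top
    then show ?thesis
      by (cases "s = 0") (use s in \<open>auto simp: ennreal_top_mult damping_def damped_def\<close>)
  qed
next
  case top
  show ?thesis
  proof (cases "s = 1")
    case True
    then show ?thesis using top by (simp add: damped_def damping_def)
  next
    case False
    then show ?thesis using top by (simp add: ennreal_mult_top)
  qed
qed

section \<open>Moments of the damped innovation\<close>

text \<open>The argument uses the pair potential only through the Boltzmann factor \<open>s\<close> by which a further point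
  multiplies the intensity, so \<open>L\<close> and \<open>s\<close> are kept abstract.\<close>

locale pair_interaction_gibbs = prob_space \<Gamma>
  for \<Gamma> :: "'a::euclidean_space set measure" +
  fixes L :: "'a \<Rightarrow> 'a set \<Rightarrow> ennreal" and s :: "'a \<Rightarrow> real"
  assumes sets_\<Gamma> [measurable_cong]: "sets \<Gamma> = sets config_space"
    and stationary: "stationary \<Gamma>"
    and papangelou: "has_papangelou_intensity \<Gamma> L"
    and measurable_L: "(\<lambda>(x, \<gamma>). L x \<gamma>) \<in> borel_measurable (borel \<Otimes>\<^sub>M config_space)"
    and measurable_s [measurable]: "s \<in> borel_measurable borel"
    and s_nonneg: "0 \<le> s x" and s_sym: "s (- x) = s x"
    and L_insert: "\<gamma> \<in> configs \<Longrightarrow> x \<notin> \<gamma> \<Longrightarrow> L y (insert x \<gamma>) = L y \<gamma> * ennreal (s (y - x))"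
    and L_translate: "\<gamma> \<in> configs \<Longrightarrow> L (v + x) ((+) v ` \<gamma>) = L x \<gamma>"
begin

lemma space_\<Gamma>: "space \<Gamma> = configs"
  using sets_eq_imp_space_eq[OF sets_\<Gamma>] by (simp add: space_config_space)

lemma measurable_L_compose [measurable (raw)]:
  assumes "f \<in> M \<rightarrow>\<^sub>M borel" and "g \<in> M \<rightarrow>\<^sub>M config_space"
  shows "(\<lambda>w. L (f w) (g w)) \<in> borel_measurable M"
proof -
  have "(\<lambda>w. (f w, g w)) \<in> M \<rightarrow>\<^sub>M borel \<Otimes>\<^sub>M config_space" using assms by measurable
  from measurable_compose[OF this measurable_L] show ?thesis by simp
qed

lemma measurable_add_remove_compose [measurable (raw)]:
  fixes f :: "'b \<Rightarrow> 'a"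
  assumes "f \<in> M \<rightarrow>\<^sub>M borel" and "g \<in> M \<rightarrow>\<^sub>M config_space"
  shows "(\<lambda>w. insert (f w) (g w)) \<in> M \<rightarrow>\<^sub>M config_space"
    and "(\<lambda>w. g w - {f w}) \<in> M \<rightarrow>\<^sub>M config_space"
proof -
  have "(\<lambda>w. (f w, g w)) \<in> M \<rightarrow>\<^sub>M borel \<Otimes>\<^sub>M config_space" using assms by measurable
  from measurable_compose[OF this measurable_add_point] measurable_compose[OF this measurable_remove_point]
  show "(\<lambda>w. insert (f w) (g w)) \<in> M \<rightarrow>\<^sub>M config_space"
    and "(\<lambda>w. g w - {f w}) \<in> M \<rightarrow>\<^sub>M config_space" by simp_all
qed

lemma gnz:
  assumes "(\<lambda>(x, \<gamma>). f x \<gamma>) \<in> borel_measurable (borel \<Otimes>\<^sub>M config_space)"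
  shows "(\<integral>\<^sup>+\<gamma>. (\<integral>\<^sup>+x. f x (\<gamma> - {x}) \<partial>count_space \<gamma>) \<partial>\<Gamma>) = (\<integral>\<^sup>+\<gamma>. (\<integral>\<^sup>+x. f x \<gamma> * L x \<gamma> \<partial>lborel) \<partial>\<Gamma>)"
  using papangelou[unfolded has_papangelou_intensity_def, rule_format, OF assms] by simp

lemma tonelli:
  assumes "(\<lambda>(x, \<gamma>). f x \<gamma>) \<in> borel_measurable (borel \<Otimes>\<^sub>M config_space)"
  shows "(\<integral>\<^sup>+\<gamma>. (\<integral>\<^sup>+x. f x \<gamma> \<partial>lborel) \<partial>\<Gamma>) = (\<integral>\<^sup>+x. (\<integral>\<^sup>+\<gamma>. f x \<gamma> \<partial>\<Gamma>) \<partial>lborel)"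
proof -
  interpret pair_sigma_finite lborel \<Gamma> ..
  have "(\<lambda>(x, \<gamma>). f x \<gamma>) \<in> borel_measurable (lborel \<Otimes>\<^sub>M \<Gamma>)"
    using assms by (subst measurable_cong_sets[OF sets_pair_measure_cong[OF sets_lborel sets_\<Gamma>] refl])
  then show ?thesis by (rule Fubini')
qed

lemma stationary_intensity:
  assumes [measurable]: "F \<in> borel_measurable borel"
  shows "(\<integral>\<^sup>+\<gamma>. F (L x \<gamma>) \<partial>\<Gamma>) = (\<integral>\<^sup>+\<gamma>. F (L 0 \<gamma>) \<partial>\<Gamma>)"
proof -
  have "(\<integral>\<^sup>+\<gamma>. F (L x \<gamma>) \<partial>\<Gamma>) = (\<integral>\<^sup>+\<gamma>. F (L x \<gamma>) \<partial>distr \<Gamma> config_space (\<lambda>\<gamma>. (+) x ` \<gamma>))"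
    using stationary by (simp add: stationary_def)
  also have "\<dots> = (\<integral>\<^sup>+\<gamma>. F (L x ((+) x ` \<gamma>)) \<partial>\<Gamma>)"
    by (subst nn_integral_distr) measurable
  also have "\<dots> = (\<integral>\<^sup>+\<gamma>. F (L 0 \<gamma>) \<partial>\<Gamma>)"
    using L_translate[of _ x 0] by (intro nn_integral_cong) (simp add: space_\<Gamma>)
  finally show ?thesis .
qed

definition mean_intensity :: ennreal where
  "mean_intensity = (\<integral>\<^sup>+\<gamma>. L 0 \<gamma> \<partial>\<Gamma>)"

definition mean_damped_intensity :: ennreal where
  "mean_damped_intensity = (\<integral>\<^sup>+\<gamma>. damped (L 0 \<gamma>) \<partial>\<Gamma>)"

text \<open>These are the sum \<open>S\<close> and the integral \<open>I\<close> whose difference is the innovation.\<close>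

definition damped_count :: "'a set \<Rightarrow> 'a set \<Rightarrow> ennreal" where
  "damped_count \<Lambda> \<gamma> = (\<integral>\<^sup>+x. indicator \<Lambda> x * damping (L x (\<gamma> - {x})) \<partial>count_space \<gamma>)"

definition damped_compensator :: "'a set \<Rightarrow> 'a set \<Rightarrow> ennreal" where
  "damped_compensator \<Lambda> \<gamma> = (\<integral>\<^sup>+x. indicator \<Lambda> x * damped (L x \<gamma>) \<partial>lborel)"

lemma expected_count:
  assumes [measurable]: "\<Lambda> \<in> sets borel"
  shows "(\<integral>\<^sup>+\<gamma>. point_count \<Lambda> \<gamma> \<partial>\<Gamma>) = mean_intensity * emeasure lborel \<Lambda>"
proof -
  have "(\<integral>\<^sup>+\<gamma>. point_count \<Lambda> \<gamma> \<partial>\<Gamma>) = (\<integral>\<^sup>+\<gamma>. (\<integral>\<^sup>+x. indicator \<Lambda> x * L x \<gamma> \<partial>lborel) \<partial>\<Gamma>)"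
    unfolding point_count_eq_nn_integral by (rule gnz) measurable
  also have "\<dots> = (\<integral>\<^sup>+x. (\<integral>\<^sup>+\<gamma>. indicator \<Lambda> x * L x \<gamma> \<partial>\<Gamma>) \<partial>lborel)"
    by (rule tonelli) measurable
  also have "\<dots> = (\<integral>\<^sup>+x. mean_intensity * indicator \<Lambda> x \<partial>lborel)"
  proof (rule nn_integral_cong)
    fix x
    have "(\<integral>\<^sup>+\<gamma>. indicator \<Lambda> x * L x \<gamma> \<partial>\<Gamma>) = indicator \<Lambda> x * (\<integral>\<^sup>+\<gamma>. L x \<gamma> \<partial>\<Gamma>)"
      by (rule nn_integral_cmult) measurable
    then show "(\<integral>\<^sup>+\<gamma>. indicator \<Lambda> x * L x \<gamma> \<partial>\<Gamma>) = mean_intensity * indicator \<Lambda> x"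
      using stationary_intensity[of "\<lambda>a. a" x] by (simp add: mean_intensity_def mult.commute)
  qed
  also have "\<dots> = mean_intensity * emeasure lborel \<Lambda>"
    by (simp add: nn_integral_cmult_indicator)
  finally show ?thesis .
qed

lemma measurable_damped_count [measurable]:
  assumes [measurable]: "\<Lambda> \<in> sets borel"
  shows "damped_count \<Lambda> \<in> borel_measurable config_space"
  unfolding damped_count_def[abs_def] by measurable

lemma measurable_damped_compensator [measurable]:
  assumes [measurable]: "\<Lambda> \<in> sets borel"
  shows "damped_compensator \<Lambda> \<in> borel_measurable config_space"
  unfolding damped_compensator_def[abs_def] by measurable

lemma expected_damped_compensator:
  assumes [measurable]: "\<Lambda> \<in> sets borel"
  shows "(\<integral>\<^sup>+\<gamma>. damped_compensator \<Lambda> \<gamma> \<partial>\<Gamma>) = mean_damped_intensity * emeasure lborel \<Lambda>"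
proof -
  have "(\<integral>\<^sup>+\<gamma>. damped_compensator \<Lambda> \<gamma> \<partial>\<Gamma>) = (\<integral>\<^sup>+x. (\<integral>\<^sup>+\<gamma>. indicator \<Lambda> x * damped (L x \<gamma>) \<partial>\<Gamma>) \<partial>lborel)"
    unfolding damped_compensator_def by (rule tonelli) measurable
  also have "\<dots> = (\<integral>\<^sup>+x. mean_damped_intensity * indicator \<Lambda> x \<partial>lborel)"
  proof (rule nn_integral_cong)
    fix x
    have "(\<integral>\<^sup>+\<gamma>. indicator \<Lambda> x * damped (L x \<gamma>) \<partial>\<Gamma>) = indicator \<Lambda> x * (\<integral>\<^sup>+\<gamma>. damped (L x \<gamma>) \<partial>\<Gamma>)"
      by (rule nn_integral_cmult) measurable
    then show "(\<integral>\<^sup>+\<gamma>. indicator \<Lambda> x * damped (L x \<gamma>) \<partial>\<Gamma>) = mean_damped_intensity * indicator \<Lambda> x"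
      using stationary_intensity[of damped x] by (simp add: mean_damped_intensity_def mult.commute)
  qed
  also have "\<dots> = mean_damped_intensity * emeasure lborel \<Lambda>"
    by (simp add: nn_integral_cmult_indicator)
  finally show ?thesis .
qed

text \<open>Removing \<open>x\<close> from \<open>\<gamma>\<close> and putting it back turns \<open>V \<gamma>\<close> into a function of \<open>x\<close> and \<open>\<gamma> - {x}\<close>, the form
  needed for the Papangelou equation. All mixed moments below are instances.\<close>

lemma gnz_damped_count:
  assumes [measurable]: "\<Lambda> \<in> sets borel" "V \<in> borel_measurable config_space"
  shows "(\<integral>\<^sup>+\<gamma>. damped_count \<Lambda> \<gamma> * V \<gamma> \<partial>\<Gamma>)
    = (\<integral>\<^sup>+\<gamma>. (\<integral>\<^sup>+x. indicator \<Lambda> x * damped (L x \<gamma>) * V (insert x \<gamma>) \<partial>lborel) \<partial>\<Gamma>)"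
proof -
  have "damped_count \<Lambda> \<gamma> * V \<gamma> = (\<integral>\<^sup>+x. indicator \<Lambda> x * damping (L x (\<gamma> - {x})) * V (insert x (\<gamma> - {x})) \<partial>count_space \<gamma>)" for \<gamma>
    unfolding damped_count_def
    by (subst nn_integral_multc[symmetric]) (auto intro!: nn_integral_cong simp: insert_absorb)
  then have "(\<integral>\<^sup>+\<gamma>. damped_count \<Lambda> \<gamma> * V \<gamma> \<partial>\<Gamma>)
    = (\<integral>\<^sup>+\<gamma>. (\<integral>\<^sup>+x. (indicator \<Lambda> x * damping (L x \<gamma>) * V (insert x \<gamma>)) * L x \<gamma> \<partial>lborel) \<partial>\<Gamma>)"
    by (simp only:) (rule gnz, measurable)
  then show ?thesis by (simp add: damped_def ac_simps)
qed

lemma AE_not_in_config: "\<gamma> \<in> configs \<Longrightarrow> AE x in lborel. x \<notin> \<gamma>"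
  by (intro AE_not_in countable_imp_null_set_lborel countable_config)

lemma expected_damped_count:
  assumes [measurable]: "\<Lambda> \<in> sets borel"
  shows "(\<integral>\<^sup>+\<gamma>. damped_count \<Lambda> \<gamma> \<partial>\<Gamma>) = (\<integral>\<^sup>+\<gamma>. damped_compensator \<Lambda> \<gamma> \<partial>\<Gamma>)"
  using gnz_damped_count[of \<Lambda> "\<lambda>_. 1"] by (simp add: damped_compensator_def)

text \<open>The surplus on the right, which becomes the covariance of the count with the innovation, arises since
  the added point is itself counted.\<close>

lemma expected_damped_count_times_count:
  assumes [measurable]: "\<Lambda> \<in> sets borel"
  shows "(\<integral>\<^sup>+\<gamma>. damped_count \<Lambda> \<gamma> * point_count \<Lambda> \<gamma> \<partial>\<Gamma>)
    = (\<integral>\<^sup>+\<gamma>. damped_compensator \<Lambda> \<gamma> * point_count \<Lambda> \<gamma> \<partial>\<Gamma>) + mean_damped_intensity * emeasure lborel \<Lambda>"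
proof -
  have "(\<integral>\<^sup>+x. indicator \<Lambda> x * damped (L x \<gamma>) * point_count \<Lambda> (insert x \<gamma>) \<partial>lborel)
      = damped_compensator \<Lambda> \<gamma> * point_count \<Lambda> \<gamma> + damped_compensator \<Lambda> \<gamma>"
    if \<gamma>: "\<gamma> \<in> configs" for \<gamma>
  proof -
    have [measurable]: "(\<lambda>x. L x \<gamma>) \<in> borel_measurable borel"
      using \<gamma> by (intro measurable_L_compose) (auto simp: space_config_space)
    have "(\<integral>\<^sup>+x. indicator \<Lambda> x * damped (L x \<gamma>) * point_count \<Lambda> (insert x \<gamma>) \<partial>lborel)
      = (\<integral>\<^sup>+x. indicator \<Lambda> x * damped (L x \<gamma>) * point_count \<Lambda> \<gamma> + indicator \<Lambda> x * damped (L x \<gamma>) \<partial>lborel)"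
    proof (intro nn_integral_cong_AE, use AE_not_in_config[OF \<gamma>] in eventually_elim)
      case (elim x)
      then have "point_count \<Lambda> (insert x \<gamma>) = indicator \<Lambda> x + point_count \<Lambda> \<gamma>"
        by (simp add: point_count_eq_nn_integral count_integral_insert)
      then show ?case by (auto split: split_indicator simp: distrib_left add.commute)
    qed
    also have "\<dots> = damped_compensator \<Lambda> \<gamma> * point_count \<Lambda> \<gamma> + damped_compensator \<Lambda> \<gamma>"
      by (simp add: nn_integral_add nn_integral_multc damped_compensator_def)
    finally show ?thesis .
  qed
  then have "(\<integral>\<^sup>+\<gamma>. damped_count \<Lambda> \<gamma> * point_count \<Lambda> \<gamma> \<partial>\<Gamma>)
    = (\<integral>\<^sup>+\<gamma>. damped_compensator \<Lambda> \<gamma> * point_count \<Lambda> \<gamma> + damped_compensator \<Lambda> \<gamma> \<partial>\<Gamma>)"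
    by (subst gnz_damped_count) (auto intro!: nn_integral_cong simp: space_\<Gamma>)
  also have "\<dots> = (\<integral>\<^sup>+\<gamma>. damped_compensator \<Lambda> \<gamma> * point_count \<Lambda> \<gamma> \<partial>\<Gamma>) + (\<integral>\<^sup>+\<gamma>. damped_compensator \<Lambda> \<gamma> \<partial>\<Gamma>)"
    by (rule nn_integral_add) measurable
  finally show ?thesis by (simp add: expected_damped_compensator)
qed

lemma measurable_L_config [measurable]: "\<gamma> \<in> configs \<Longrightarrow> (\<lambda>x. L x \<gamma>) \<in> borel_measurable borel"
  by (intro measurable_L_compose) (auto simp: space_config_space)

lemma s_minus_commute: "s (x - y) = s (y - x)"
  using s_sym[of "x - y"] by simp

lemma lborel_swap:
  assumes "(\<lambda>(x, y). f x y) \<in> borel_measurable (borel \<Otimes>\<^sub>M borel)"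
  shows "(\<integral>\<^sup>+y. (\<integral>\<^sup>+x. f x y \<partial>lborel) \<partial>(lborel :: 'a measure)) = (\<integral>\<^sup>+x. (\<integral>\<^sup>+y. f x y \<partial>lborel) \<partial>(lborel :: 'a measure))"
proof -
  have "(\<lambda>(x, y). f x y) \<in> borel_measurable (lborel \<Otimes>\<^sub>M (lborel :: 'a measure))"
    using assms by (subst measurable_cong_sets[OF sets_pair_measure_cong[OF sets_lborel sets_lborel] refl])
  then show ?thesis by (rule lborel_pair.Fubini')
qed

lemma expected_damped_count_times_compensator:
  assumes [measurable]: "\<Lambda> \<in> sets borel"
  shows "(\<integral>\<^sup>+\<gamma>. damped_count \<Lambda> \<gamma> * damped_compensator \<Lambda> \<gamma> \<partial>\<Gamma>)
    = (\<integral>\<^sup>+\<gamma>. (\<integral>\<^sup>+x. (\<integral>\<^sup>+y. indicator \<Lambda> x * indicator \<Lambda> y *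
        (damped (L x \<gamma>) * damped (L y \<gamma> * ennreal (s (x - y)))) \<partial>lborel) \<partial>lborel) \<partial>\<Gamma>)"
  unfolding gnz_damped_count[OF assms measurable_damped_compensator[OF assms]]
proof (rule nn_integral_cong)
  fix \<gamma> assume "\<gamma> \<in> space \<Gamma>"
  then have \<gamma>: "\<gamma> \<in> configs" by (simp add: space_\<Gamma>)
  note [measurable] = measurable_L_config[OF \<gamma>]
  show "(\<integral>\<^sup>+x. indicator \<Lambda> x * damped (L x \<gamma>) * damped_compensator \<Lambda> (insert x \<gamma>) \<partial>lborel)
    = (\<integral>\<^sup>+x. (\<integral>\<^sup>+y. indicator \<Lambda> x * indicator \<Lambda> y *
        (damped (L x \<gamma>) * damped (L y \<gamma> * ennreal (s (x - y)))) \<partial>lborel) \<partial>lborel)"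
  proof (intro nn_integral_cong_AE, use AE_not_in_config[OF \<gamma>] in eventually_elim)
    case (elim x)
    then show ?case
      unfolding damped_compensator_def L_insert[OF \<gamma> elim] s_minus_commute[of _ x]
      by (subst nn_integral_cmult[symmetric]) (auto simp: ac_simps)
  qed
qed

lemma damped_count_insert:
  assumes "\<gamma> \<in> configs" "x \<notin> \<gamma>"
  shows "damped_count \<Lambda> (insert x \<gamma>) = indicator \<Lambda> x * damping (L x \<gamma>)
    + (\<integral>\<^sup>+y. indicator \<Lambda> y * damping (L y (insert x (\<gamma> - {y}))) \<partial>count_space \<gamma>)"
proof -
  have "insert x \<gamma> - {y} = insert x (\<gamma> - {y})" if "y \<in> \<gamma>" for y
    using assms that by auto
  then show ?thesis
    unfolding damped_count_def using assms
    by (subst count_integral_insert) (auto intro!: arg_cong2[where f = "(+)"] nn_integral_cong)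
qed

text \<open>The sum over \<open>y\<close> left over from a first application of the Papangelou equation is removed by a second
  one. For this the integral over \<open>x\<close> has to be moved inside the sum over \<open>y\<close>; then it is a function
  of \<open>y\<close> and \<open>\<gamma> - {y}\<close>.\<close>

lemma expected_off_diagonal:
  assumes [measurable]: "\<Lambda> \<in> sets borel"
  shows "(\<integral>\<^sup>+\<gamma>. (\<integral>\<^sup>+x. indicator \<Lambda> x * damped (L x \<gamma>) *
        (\<integral>\<^sup>+y. indicator \<Lambda> y * damping (L y (insert x (\<gamma> - {y}))) \<partial>count_space \<gamma>) \<partial>lborel) \<partial>\<Gamma>)
    = (\<integral>\<^sup>+\<gamma>. (\<integral>\<^sup>+x. (\<integral>\<^sup>+y. indicator \<Lambda> x * indicator \<Lambda> y * (damped (L x \<gamma> * ennreal (s (x - y))) *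
        (damping (L y \<gamma> * ennreal (s (x - y))) * L y \<gamma>)) \<partial>lborel) \<partial>lborel) \<partial>\<Gamma>)"
proof -
  let ?f = "\<lambda>x y \<eta>. indicator \<Lambda> x * indicator \<Lambda> y *
    (damped (L x (insert y \<eta>)) * damping (L y (insert x \<eta>))) :: ennreal"
  have swap: "(\<integral>\<^sup>+x. indicator \<Lambda> x * damped (L x \<gamma>) *
        (\<integral>\<^sup>+y. indicator \<Lambda> y * damping (L y (insert x (\<gamma> - {y}))) \<partial>count_space \<gamma>) \<partial>lborel)
      = (\<integral>\<^sup>+y. (\<integral>\<^sup>+x. ?f x y (\<gamma> - {y}) \<partial>lborel) \<partial>count_space \<gamma>)" if \<gamma>: "\<gamma> \<in> configs" for \<gamma>
  proof -
    interpret C: sigma_finite_measure "count_space \<gamma>"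
      by (rule sigma_finite_measure_count_space_countable[OF countable_config[OF \<gamma>]])
    interpret pair_sigma_finite "count_space \<gamma>" "lborel :: 'a measure" ..
    have [measurable]: "(\<lambda>x. \<gamma> - {y}) \<in> borel \<rightarrow>\<^sub>M (config_space :: 'a set measure)" for y
      using \<gamma> by (simp add: space_config_space configs_Diff)
    have meas: "(\<lambda>(y, x). ?f x y (\<gamma> - {y})) \<in> borel_measurable (count_space \<gamma> \<Otimes>\<^sub>M lborel)"
      by (rule measurable_pair_measure_countable1[OF countable_config[OF \<gamma>]]) (unfold prod.case, measurable)
    have "(\<integral>\<^sup>+x. indicator \<Lambda> x * damped (L x \<gamma>) *
        (\<integral>\<^sup>+y. indicator \<Lambda> y * damping (L y (insert x (\<gamma> - {y}))) \<partial>count_space \<gamma>) \<partial>lborel)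
      = (\<integral>\<^sup>+x. (\<integral>\<^sup>+y. ?f x y (\<gamma> - {y}) \<partial>count_space \<gamma>) \<partial>lborel)"
      by (subst nn_integral_cmult[symmetric]) (auto intro!: nn_integral_cong simp: insert_absorb ac_simps)
    also have "\<dots> = (\<integral>\<^sup>+y. (\<integral>\<^sup>+x. ?f x y (\<gamma> - {y}) \<partial>lborel) \<partial>count_space \<gamma>)"
      by (rule Fubini'[OF meas])
    finally show ?thesis .
  qed
  have "(\<integral>\<^sup>+\<gamma>. (\<integral>\<^sup>+x. indicator \<Lambda> x * damped (L x \<gamma>) *
        (\<integral>\<^sup>+y. indicator \<Lambda> y * damping (L y (insert x (\<gamma> - {y}))) \<partial>count_space \<gamma>) \<partial>lborel) \<partial>\<Gamma>)
      = (\<integral>\<^sup>+\<gamma>. (\<integral>\<^sup>+y. (\<integral>\<^sup>+x. ?f x y (\<gamma> - {y}) \<partial>lborel) \<partial>count_space \<gamma>) \<partial>\<Gamma>)"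
    using swap by (intro nn_integral_cong) (simp add: space_\<Gamma>)
  also have "\<dots> = (\<integral>\<^sup>+\<gamma>. (\<integral>\<^sup>+y. (\<integral>\<^sup>+x. ?f x y \<gamma> \<partial>lborel) * L y \<gamma> \<partial>lborel) \<partial>\<Gamma>)"
    by (rule gnz) measurable
  also have "\<dots> = (\<integral>\<^sup>+\<gamma>. (\<integral>\<^sup>+x. (\<integral>\<^sup>+y. indicator \<Lambda> x * indicator \<Lambda> y * (damped (L x \<gamma> * ennreal (s (x - y))) *
        (damping (L y \<gamma> * ennreal (s (x - y))) * L y \<gamma>)) \<partial>lborel) \<partial>lborel) \<partial>\<Gamma>)"
  proof (rule nn_integral_cong)
    fix \<gamma> assume "\<gamma> \<in> space \<Gamma>"
    then have \<gamma>: "\<gamma> \<in> configs" by (simp add: space_\<Gamma>)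
    note [measurable] = measurable_L_config[OF \<gamma>]
    let ?g = "\<lambda>x y. indicator \<Lambda> x * indicator \<Lambda> y * (damped (L x \<gamma> * ennreal (s (x - y))) *
        (damping (L y \<gamma> * ennreal (s (x - y))) * L y \<gamma>)) :: ennreal"
    have "(\<integral>\<^sup>+y. (\<integral>\<^sup>+x. ?f x y \<gamma> \<partial>lborel) * L y \<gamma> \<partial>lborel) = (\<integral>\<^sup>+y. (\<integral>\<^sup>+x. ?g x y \<partial>lborel) \<partial>lborel)"
    proof (intro nn_integral_cong_AE, use AE_not_in_config[OF \<gamma>] in eventually_elim)
      case (elim y)
      have [measurable]: "(\<lambda>x. L x (insert y \<gamma>)) \<in> borel_measurable borel"
        "(\<lambda>x. L y (insert x \<gamma>)) \<in> borel_measurable borel"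
        using \<gamma> by (intro measurable_L_compose measurable_add_remove_compose; auto simp: space_config_space configs_insert)+
      have "(\<integral>\<^sup>+x. ?f x y \<gamma> \<partial>lborel) * L y \<gamma> = (\<integral>\<^sup>+x. ?f x y \<gamma> * L y \<gamma> \<partial>lborel)"
        by (rule nn_integral_multc[symmetric]) measurable
      also have "\<dots> = (\<integral>\<^sup>+x. ?g x y \<partial>lborel)"
      proof (intro nn_integral_cong_AE, use AE_not_in_config[OF \<gamma>] in eventually_elim)
        case (elim x)
        then show ?case
          using \<open>y \<notin> \<gamma>\<close> by (simp add: L_insert[OF \<gamma>] s_minus_commute[of y x] ac_simps)
      qed
      finally show ?case .
    qed
    also have "\<dots> = (\<integral>\<^sup>+x. (\<integral>\<^sup>+y. ?g x y \<partial>lborel) \<partial>lborel)"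
      by (rule lborel_swap) measurable
    finally show "(\<integral>\<^sup>+y. (\<integral>\<^sup>+x. ?f x y \<gamma> \<partial>lborel) * L y \<gamma> \<partial>lborel) = (\<integral>\<^sup>+x. (\<integral>\<^sup>+y. ?g x y \<partial>lborel) \<partial>lborel)" .
  qed
  finally show ?thesis .
qed

text \<open>The volume term is the diagonal of the double sum over the points.\<close>

lemma expected_damped_count_square:
  assumes [measurable]: "\<Lambda> \<in> sets borel"
  shows "(\<integral>\<^sup>+\<gamma>. damped_count \<Lambda> \<gamma> * damped_count \<Lambda> \<gamma> \<partial>\<Gamma>) \<le> emeasure lborel \<Lambda>
    + (\<integral>\<^sup>+\<gamma>. (\<integral>\<^sup>+x. (\<integral>\<^sup>+y. indicator \<Lambda> x * indicator \<Lambda> y * (damped (L x \<gamma> * ennreal (s (x - y))) *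
        (damping (L y \<gamma> * ennreal (s (x - y))) * L y \<gamma>)) \<partial>lborel) \<partial>lborel) \<partial>\<Gamma>)"
proof -
  let ?T = "\<lambda>x \<gamma>. \<integral>\<^sup>+y. indicator \<Lambda> y * damping (L y (insert x (\<gamma> - {y}))) \<partial>count_space \<gamma>"
  have "(\<integral>\<^sup>+\<gamma>. damped_count \<Lambda> \<gamma> * damped_count \<Lambda> \<gamma> \<partial>\<Gamma>)
      = (\<integral>\<^sup>+\<gamma>. (\<integral>\<^sup>+x. indicator \<Lambda> x * damped (L x \<gamma>) * damped_count \<Lambda> (insert x \<gamma>) \<partial>lborel) \<partial>\<Gamma>)"
    by (rule gnz_damped_count) measurable
  also have "\<dots> \<le> (\<integral>\<^sup>+\<gamma>. emeasure lborel \<Lambda> + (\<integral>\<^sup>+x. indicator \<Lambda> x * damped (L x \<gamma>) * ?T x \<gamma> \<partial>lborel) \<partial>\<Gamma>)"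
  proof (intro nn_integral_mono)
    fix \<gamma> assume "\<gamma> \<in> space \<Gamma>"
    then have \<gamma>: "\<gamma> \<in> configs" by (simp add: space_\<Gamma>)
    then have [measurable]: "(\<lambda>x. \<gamma>) \<in> borel \<rightarrow>\<^sub>M (config_space :: 'a set measure)"
      by (simp add: space_config_space)
    have "(\<integral>\<^sup>+x. indicator \<Lambda> x * damped (L x \<gamma>) * damped_count \<Lambda> (insert x \<gamma>) \<partial>lborel)
      \<le> (\<integral>\<^sup>+x. indicator \<Lambda> x + indicator \<Lambda> x * damped (L x \<gamma>) * ?T x \<gamma> \<partial>lborel)"
    proof (intro nn_integral_mono_AE, use AE_not_in_config[OF \<gamma>] in eventually_elim)
      case (elim x)
      have "damped (L x \<gamma>) * damping (L x \<gamma>) \<le> 1 * 1"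
        by (intro mult_mono damped_le_1 damping_le_1) auto
      then show ?case
        unfolding damped_count_insert[OF \<gamma> elim]
        by (auto simp: distrib_left add_right_mono split: split_indicator)
    qed
    also have "\<dots> = emeasure lborel \<Lambda> + (\<integral>\<^sup>+x. indicator \<Lambda> x * damped (L x \<gamma>) * ?T x \<gamma> \<partial>lborel)"
      by (subst nn_integral_add) simp_all
    finally show "(\<integral>\<^sup>+x. indicator \<Lambda> x * damped (L x \<gamma>) * damped_count \<Lambda> (insert x \<gamma>) \<partial>lborel) \<le> \<dots>" .
  qed
  also have "\<dots> = emeasure lborel \<Lambda> + (\<integral>\<^sup>+\<gamma>. (\<integral>\<^sup>+x. indicator \<Lambda> x * damped (L x \<gamma>) * ?T x \<gamma> \<partial>lborel) \<partial>\<Gamma>)"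
    by (subst nn_integral_add) (simp_all add: emeasure_space_1)
  finally show ?thesis unfolding expected_off_diagonal[OF assms] .
qed

definition interaction_strength :: ennreal where
  "interaction_strength = (\<integral>\<^sup>+y. ennreal \<bar>1 - s y\<bar> \<partial>lborel)"

lemma interaction_strength_shift: "(\<integral>\<^sup>+y. ennreal \<bar>1 - s (x - y)\<bar> \<partial>lborel) = interaction_strength"
proof -
  have "interaction_strength = (\<integral>\<^sup>+y. ennreal \<bar>1 - s y\<bar> \<partial>distr lborel borel ((+) (- x)))"
    by (simp add: interaction_strength_def lborel_distr_plus)
  also have "\<dots> = (\<integral>\<^sup>+y. ennreal \<bar>1 - s (x - y)\<bar> \<partial>lborel)"
    unfolding s_minus_commute[of x] by (subst nn_integral_distr) simp_all
  finally show ?thesis by simp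
qed

lemma damped_compensator_square:
  assumes [measurable]: "\<Lambda> \<in> sets borel" and \<gamma>: "\<gamma> \<in> configs"
  shows "damped_compensator \<Lambda> \<gamma> * damped_compensator \<Lambda> \<gamma>
    = (\<integral>\<^sup>+x. (\<integral>\<^sup>+y. indicator \<Lambda> x * indicator \<Lambda> y * (damped (L x \<gamma>) * damped (L y \<gamma>)) \<partial>lborel) \<partial>lborel)"
proof -
  note [measurable] = measurable_L_config[OF \<gamma>]
  have "damped_compensator \<Lambda> \<gamma> * damped_compensator \<Lambda> \<gamma>
    = (\<integral>\<^sup>+x. indicator \<Lambda> x * damped (L x \<gamma>) * damped_compensator \<Lambda> \<gamma> \<partial>lborel)"
    by (subst nn_integral_multc) (simp_all add: damped_compensator_def)
  also have "\<dots> = (\<integral>\<^sup>+x. (\<integral>\<^sup>+y. indicator \<Lambda> x * indicator \<Lambda> y * (damped (L x \<gamma>) * damped (L y \<gamma>)) \<partial>lborel) \<partial>lborel)"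
    unfolding damped_compensator_def
    by (subst nn_integral_cmult[symmetric]) (auto intro!: nn_integral_cong simp: ac_simps)
  finally show ?thesis .
qed

text \<open>The inequality \<open>damped_correlation_bound\<close> integrated over \<open>\<Lambda> \<times> \<Lambda>\<close>. The two mixed terms on its
  right-hand side differ by exchanging \<open>x\<close> and \<open>y\<close>, hence have the same integral \<open>B\<close>.\<close>

lemma pairwise_bound:
  assumes [measurable]: "\<Lambda> \<in> sets borel" and \<gamma>: "\<gamma> \<in> configs"
  defines "A \<equiv> (\<integral>\<^sup>+x. (\<integral>\<^sup>+y. indicator \<Lambda> x * indicator \<Lambda> y * (damped (L x \<gamma> * ennreal (s (x - y))) *
        (damping (L y \<gamma> * ennreal (s (x - y))) * L y \<gamma>)) \<partial>lborel) \<partial>lborel)"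
    and "B \<equiv> (\<integral>\<^sup>+x. (\<integral>\<^sup>+y. indicator \<Lambda> x * indicator \<Lambda> y *
        (damped (L x \<gamma>) * damped (L y \<gamma> * ennreal (s (x - y)))) \<partial>lborel) \<partial>lborel)"
  shows "A + damped_compensator \<Lambda> \<gamma> * damped_compensator \<Lambda> \<gamma>
    \<le> 2 * B + interaction_strength * (\<integral>\<^sup>+x. indicator \<Lambda> x * (2 + L x \<gamma>) \<partial>lborel)"
proof -
  note [measurable] = measurable_L_config[OF \<gamma>]
  let ?i = "\<lambda>x y. indicator \<Lambda> x * indicator \<Lambda> y :: ennreal"
  let ?A = "\<lambda>x y. ?i x y * (damped (L x \<gamma> * ennreal (s (x - y))) * (damping (L y \<gamma> * ennreal (s (x - y))) * L y \<gamma>))"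
  let ?C = "\<lambda>x y. ?i x y * (damped (L x \<gamma>) * damped (L y \<gamma>))"
  let ?B = "\<lambda>x y. ?i x y * (damped (L x \<gamma>) * damped (L y \<gamma> * ennreal (s (x - y))))"
  let ?R = "\<lambda>x y. indicator \<Lambda> x * (2 + L x \<gamma>) * ennreal \<bar>1 - s (x - y)\<bar>"
  have B': "B = (\<integral>\<^sup>+x. (\<integral>\<^sup>+y. ?B y x \<partial>lborel) \<partial>lborel)"
    unfolding B_def by (rule lborel_swap) measurable
  have "A + damped_compensator \<Lambda> \<gamma> * damped_compensator \<Lambda> \<gamma> = (\<integral>\<^sup>+x. (\<integral>\<^sup>+y. ?A x y + ?C x y \<partial>lborel) \<partial>lborel)"
    unfolding A_def damped_compensator_square[OF assms(1) \<gamma>]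
    by (subst nn_integral_add[symmetric]; (measurable)?) (auto intro!: nn_integral_cong simp: nn_integral_add)
  also have "\<dots> \<le> (\<integral>\<^sup>+x. (\<integral>\<^sup>+y. ?B x y + ?B y x + ?R x y \<partial>lborel) \<partial>lborel)"
  proof (intro nn_integral_mono)
    fix x y
    show "?A x y + ?C x y \<le> ?B x y + ?B y x + ?R x y"
      using damped_correlation_bound[OF s_nonneg, of "L x \<gamma>" "x - y" "L y \<gamma>"]
      by (auto simp: s_minus_commute[of y x] mult.commute[of "2 + L x \<gamma>"] split: split_indicator)
  qed
  also have "\<dots> = B + B + (\<integral>\<^sup>+x. (\<integral>\<^sup>+y. ?R x y \<partial>lborel) \<partial>lborel)"
    by (subst (2) B') (simp add: B_def nn_integral_add)
  also have "(\<integral>\<^sup>+x. (\<integral>\<^sup>+y. ?R x y \<partial>lborel) \<partial>lborel)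
      = interaction_strength * (\<integral>\<^sup>+x. indicator \<Lambda> x * (2 + L x \<gamma>) \<partial>lborel)"
    by (simp add: nn_integral_cmult nn_integral_multc interaction_strength_shift mult.commute[of interaction_strength])
  finally show ?thesis by (simp add: mult_2)
qed

text \<open>This says that the innovation \<open>damped_count - damped_compensator\<close> has a second moment of at most the
  order of the volume. The square is expanded and its negative term moved to the other side, so that
  subtraction of possibly infinite quantities does not occur.\<close>

lemma second_moment_bound:
  assumes [measurable]: "\<Lambda> \<in> sets borel"
  shows "(\<integral>\<^sup>+\<gamma>. damped_count \<Lambda> \<gamma> * damped_count \<Lambda> \<gamma> \<partial>\<Gamma>)
      + (\<integral>\<^sup>+\<gamma>. damped_compensator \<Lambda> \<gamma> * damped_compensator \<Lambda> \<gamma> \<partial>\<Gamma>)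
    \<le> 2 * (\<integral>\<^sup>+\<gamma>. damped_count \<Lambda> \<gamma> * damped_compensator \<Lambda> \<gamma> \<partial>\<Gamma>)
      + (1 + interaction_strength * (2 + mean_intensity)) * emeasure lborel \<Lambda>"
proof -
  define A where "A \<gamma> = (\<integral>\<^sup>+x. (\<integral>\<^sup>+y. indicator \<Lambda> x * indicator \<Lambda> y * (damped (L x \<gamma> * ennreal (s (x - y))) *
        (damping (L y \<gamma> * ennreal (s (x - y))) * L y \<gamma>)) \<partial>lborel) \<partial>lborel)" for \<gamma>
  define B where "B \<gamma> = (\<integral>\<^sup>+x. (\<integral>\<^sup>+y. indicator \<Lambda> x * indicator \<Lambda> y *
        (damped (L x \<gamma>) * damped (L y \<gamma> * ennreal (s (x - y)))) \<partial>lborel) \<partial>lborel)" for \<gamma>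
  have [measurable]: "A \<in> borel_measurable config_space" "B \<in> borel_measurable config_space"
    unfolding A_def[abs_def] B_def[abs_def] by measurable
  have R: "(\<integral>\<^sup>+\<gamma>. (\<integral>\<^sup>+x. indicator \<Lambda> x * (2 + L x \<gamma>) \<partial>lborel) \<partial>\<Gamma>) = (2 + mean_intensity) * emeasure lborel \<Lambda>"
  proof -
    have "(\<integral>\<^sup>+\<gamma>. (\<integral>\<^sup>+x. indicator \<Lambda> x * (2 + L x \<gamma>) \<partial>lborel) \<partial>\<Gamma>)
        = (\<integral>\<^sup>+x. (\<integral>\<^sup>+\<gamma>. indicator \<Lambda> x * (2 + L x \<gamma>) \<partial>\<Gamma>) \<partial>lborel)"
      by (rule tonelli) measurable
    also have "\<dots> = (\<integral>\<^sup>+x. (2 + mean_intensity) * indicator \<Lambda> x \<partial>lborel)"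
    proof (rule nn_integral_cong)
      fix x
      have "(\<integral>\<^sup>+\<gamma>. indicator \<Lambda> x * (2 + L x \<gamma>) \<partial>\<Gamma>) = indicator \<Lambda> x * (2 + (\<integral>\<^sup>+\<gamma>. L x \<gamma> \<partial>\<Gamma>))"
        by (simp add: nn_integral_cmult nn_integral_add emeasure_space_1)
      then show "(\<integral>\<^sup>+\<gamma>. indicator \<Lambda> x * (2 + L x \<gamma>) \<partial>\<Gamma>) = (2 + mean_intensity) * indicator \<Lambda> x"
        using stationary_intensity[of "\<lambda>a. a" x] by (simp add: mean_intensity_def mult.commute)
    qed
    finally show ?thesis by (simp add: nn_integral_cmult_indicator)
  qed
  have "(\<integral>\<^sup>+\<gamma>. damped_count \<Lambda> \<gamma> * damped_count \<Lambda> \<gamma> \<partial>\<Gamma>)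
      + (\<integral>\<^sup>+\<gamma>. damped_compensator \<Lambda> \<gamma> * damped_compensator \<Lambda> \<gamma> \<partial>\<Gamma>)
    \<le> emeasure lborel \<Lambda> + (\<integral>\<^sup>+\<gamma>. A \<gamma> \<partial>\<Gamma>) + (\<integral>\<^sup>+\<gamma>. damped_compensator \<Lambda> \<gamma> * damped_compensator \<Lambda> \<gamma> \<partial>\<Gamma>)"
    using expected_damped_count_square[OF assms] unfolding A_def by (intro add_right_mono)
  also have "\<dots> = emeasure lborel \<Lambda> + (\<integral>\<^sup>+\<gamma>. A \<gamma> + damped_compensator \<Lambda> \<gamma> * damped_compensator \<Lambda> \<gamma> \<partial>\<Gamma>)"
    by (subst nn_integral_add) (simp_all add: add.assoc)
  also have "\<dots> \<le> emeasure lborel \<Lambda> + (\<integral>\<^sup>+\<gamma>. 2 * B \<gamma>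
      + interaction_strength * (\<integral>\<^sup>+x. indicator \<Lambda> x * (2 + L x \<gamma>) \<partial>lborel) \<partial>\<Gamma>)"
    unfolding A_def B_def
    by (intro add_left_mono nn_integral_mono pairwise_bound) (simp_all add: space_\<Gamma>)
  also have "\<dots> = emeasure lborel \<Lambda> + (2 * (\<integral>\<^sup>+\<gamma>. B \<gamma> \<partial>\<Gamma>)
      + interaction_strength * ((2 + mean_intensity) * emeasure lborel \<Lambda>))"
    by (simp add: nn_integral_add nn_integral_cmult R)
  also have "(\<integral>\<^sup>+\<gamma>. B \<gamma> \<partial>\<Gamma>) = (\<integral>\<^sup>+\<gamma>. damped_count \<Lambda> \<gamma> * damped_compensator \<Lambda> \<gamma> \<partial>\<Gamma>)"
    unfolding B_def by (rule expected_damped_count_times_compensator[symmetric]) measurable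
  finally show ?thesis by (simp add: distrib_right distrib_left ac_simps)
qed

end

section \<open>Lower bound for the variance\<close>

lemma integrable_mult_of_squares:
  fixes X Y :: "'w \<Rightarrow> real"
  assumes [measurable]: "X \<in> borel_measurable M" "Y \<in> borel_measurable M"
    and "integrable M (\<lambda>w. X w ^ 2)" "integrable M (\<lambda>w. Y w ^ 2)"
  shows "integrable M (\<lambda>w. X w * Y w)"
proof (rule Bochner_Integration.integrable_bound)
  show "integrable M (\<lambda>w. X w ^ 2 + Y w ^ 2)" using assms by simp
  have "\<bar>X w * Y w\<bar> \<le> X w ^ 2 + Y w ^ 2" for w
    using sum_squares_bound[of "\<bar>X w\<bar>" "\<bar>Y w\<bar>"] abs_ge_zero[of "X w * Y w"]
    unfolding abs_mult power2_abs by linarith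
  then show "AE w in M. norm (X w * Y w) \<le> norm (X w ^ 2 + Y w ^ 2)" by simp
qed measurable

text \<open>The Cauchy--Schwarz inequality for \<open>X - E X\<close> and \<open>Y\<close>, with only an upper bound on the second moment of \<open>Y\<close>.\<close>

lemma (in prob_space) variance_ge_of_correlation:
  fixes X Y :: "'a \<Rightarrow> real"
  assumes [measurable]: "X \<in> borel_measurable M" "Y \<in> borel_measurable M"
    and X2: "integrable M (\<lambda>w. X w ^ 2)" and Y2: "integrable M (\<lambda>w. Y w ^ 2)"
    and centred: "expectation Y = 0" and V: "expectation (\<lambda>w. Y w ^ 2) \<le> V" "0 < V"
  shows "(expectation (\<lambda>w. X w * Y w))\<^sup>2 / V \<le> variance X"
proof -
  \<comment> \<open>\<open>t\<close> minimises the quadratic upper bound for \<open>E[(X - m - t Y)\<^sup>2]\<close> obtained from \<open>V\<close>.\<close>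
  define m c t where "m = expectation X" and "c = expectation (\<lambda>w. X w * Y w)" and "t = c / V"
  have iX: "integrable M X" and iY: "integrable M Y"
    using X2 Y2 by (auto intro: square_integrable_imp_integrable)
  have iXY: "integrable M (\<lambda>w. X w * Y w)"
    using X2 Y2 by (intro integrable_mult_of_squares) auto
  have iXm: "integrable M (\<lambda>w. (X w - m)\<^sup>2)"
    using X2 iX by (simp add: power2_diff)
  have "0 \<le> expectation (\<lambda>w. (X w - m - t * Y w)\<^sup>2)"
    by (intro Bochner_Integration.integral_nonneg) simp
  also have "(\<lambda>w. (X w - m - t * Y w)\<^sup>2)
      = (\<lambda>w. (X w - m)\<^sup>2 - (2 * t) * (X w * Y w) + (2 * t * m) * Y w + t\<^sup>2 * (Y w)\<^sup>2)"
    by (auto simp: power2_eq_square algebra_simps)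
  also have "expectation \<dots> = variance X - 2 * t * c + t\<^sup>2 * expectation (\<lambda>w. Y w ^ 2)"
    using iXm iXY iY Y2 centred by (simp add: m_def[symmetric] c_def)
  also have "\<dots> \<le> variance X - 2 * t * c + t\<^sup>2 * V"
    using V by (intro add_left_mono mult_left_mono) auto
  also have "\<dots> = variance X - c\<^sup>2 / V"
    using V(2) unfolding t_def by (simp add: power2_eq_square field_simps)
  finally show ?thesis by (simp add: c_def)
qed

context pair_interaction_gibbs
begin

lemma mean_damped_intensity_le_1: "mean_damped_intensity \<le> 1"
proof -
  have "mean_damped_intensity \<le> (\<integral>\<^sup>+\<gamma>. 1 \<partial>\<Gamma>)"
    unfolding mean_damped_intensity_def by (intro nn_integral_mono damped_le_1)
  then show ?thesis by (simp add: emeasure_space_1)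
qed

text \<open>If the mean vanishes then the intensity is zero almost surely, so the process has no points; but at the
  empty configuration the intensity is not zero.\<close>

lemma mean_damped_intensity_pos:
  assumes "mean_intensity < \<infinity>" and "L 0 {} \<noteq> 0"
  shows "0 < mean_damped_intensity"
proof (rule ccontr)
  have [measurable]: "(\<lambda>\<gamma>. L 0 \<gamma>) \<in> borel_measurable \<Gamma>" by measurable
  assume "\<not> 0 < mean_damped_intensity"
  then have "(\<integral>\<^sup>+\<gamma>. damped (L 0 \<gamma>) \<partial>\<Gamma>) = 0"
    by (simp add: mean_damped_intensity_def)
  then have "AE \<gamma> in \<Gamma>. damped (L 0 \<gamma>) = 0"
    by (subst (asm) nn_integral_0_iff_AE) auto
  moreover have "AE \<gamma> in \<Gamma>. L 0 \<gamma> \<noteq> \<infinity>"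
    using assms(1) unfolding mean_intensity_def by (intro nn_integral_PInf_AE) auto
  ultimately have zero: "AE \<gamma> in \<Gamma>. L 0 \<gamma> = 0"
    by eventually_elim (simp add: damped_eq_0_iff)
  then have "mean_intensity = 0"
    unfolding mean_intensity_def by (subst nn_integral_0_iff_AE) auto
  \<comment> \<open>The whole space has infinite volume, but \<open>0 * \<infinity> = 0\<close>.\<close>
  then have "(\<integral>\<^sup>+\<gamma>. point_count UNIV \<gamma> \<partial>\<Gamma>) = 0" by (simp add: expected_count)
  then have "AE \<gamma> in \<Gamma>. point_count UNIV \<gamma> = 0"
    by (subst (asm) nn_integral_0_iff_AE) auto
  with zero have "AE \<gamma> in \<Gamma>. False"
  proof eventually_elim
    case (elim \<gamma>)
    then have "\<gamma> = {}" by (simp add: point_count_def emeasure_count_space_eq_0)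
    with elim assms(2) show False by simp
  qed
  then show False by simp
qed

lemma damped_count_le: "damped_count \<Lambda> \<gamma> \<le> point_count \<Lambda> \<gamma>"
  unfolding damped_count_def point_count_eq_nn_integral
  using damping_le_1 by (intro nn_integral_mono) (auto split: split_indicator)

lemma damped_compensator_le:
  assumes [measurable]: "\<Lambda> \<in> sets borel"
  shows "damped_compensator \<Lambda> \<gamma> \<le> emeasure lborel \<Lambda>"
proof -
  have "damped_compensator \<Lambda> \<gamma> \<le> (\<integral>\<^sup>+x. indicator \<Lambda> x \<partial>lborel)"
    unfolding damped_compensator_def
    using damped_le_1 by (intro nn_integral_mono) (auto split: split_indicator)
  then show ?thesis by simp
qed

lemma measurable_card [measurable]:
  assumes [measurable]: "\<Lambda> \<in> sets borel" and "bounded \<Lambda>"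
  shows "(\<lambda>\<gamma>. real (card (\<gamma> \<inter> \<Lambda>))) \<in> borel_measurable \<Gamma>"
proof -
  have "(\<lambda>\<gamma>. enn2real (point_count \<Lambda> \<gamma>)) \<in> borel_measurable \<Gamma>" by measurable
  then show ?thesis
    by (rule measurable_cong[THEN iffD1, rotated]) (use assms in \<open>simp add: space_\<Gamma> point_count_eq_card\<close>)
qed

text \<open>The test variable is the innovation \<open>Y = S - I\<close>. Because of \<open>S \<le> N\<close> and \<open>I \<le> \<bar>\<Lambda>\<bar>\<close> all expectations are
  finite, and the identities for nonnegative integrals can be read as identities between reals.\<close>

lemma variance_lower_bound:
  assumes \<Lambda> [measurable]: "\<Lambda> \<in> sets borel" and bounded: "bounded \<Lambda>"
    and v_pos: "0 < measure lborel \<Lambda>"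
    and X2: "integrable \<Gamma> (\<lambda>\<gamma>. real (card (\<gamma> \<inter> \<Lambda>)) ^ 2)"
    and finite: "interaction_strength < \<infinity>" "mean_intensity < \<infinity>"
  shows "(enn2real mean_damped_intensity)\<^sup>2 / enn2real (1 + interaction_strength * (2 + mean_intensity))
      * measure lborel \<Lambda> \<le> variance (\<lambda>\<gamma>. real (card (\<gamma> \<inter> \<Lambda>)))"
proof -
  define v where "v = measure lborel \<Lambda>"
  have emv: "emeasure lborel \<Lambda> = ennreal v"
    unfolding v_def using emeasure_bounded_finite[OF bounded] by (intro emeasure_eq_ennreal_measure) auto
  have v: "0 < v" using v_pos by (simp add: v_def)
  define c where "c = enn2real mean_damped_intensity"
  have c: "mean_damped_intensity = ennreal c" "0 \<le> c"
    using le_less_trans[OF mean_damped_intensity_le_1 ennreal_one_less_top] by (simp_all add: c_def)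
  define D where "D = enn2real (1 + interaction_strength * (2 + mean_intensity))"
  have fin: "1 + interaction_strength * (2 + mean_intensity) < \<infinity>"
    using finite by (simp add: ennreal_mult_less_top)
  then have D: "1 + interaction_strength * (2 + mean_intensity) = ennreal D" by (simp add: D_def)
  have D1: "1 \<le> D"
  proof -
    have "ennreal 1 \<le> ennreal D" unfolding D[symmetric] by simp
    then show ?thesis by (simp add: D_def)
  qed
  define X where "X \<gamma> = real (card (\<gamma> \<inter> \<Lambda>))" for \<gamma>
  define S where "S \<gamma> = enn2real (damped_count \<Lambda> \<gamma>)" for \<gamma>
  define I where "I \<gamma> = enn2real (damped_compensator \<Lambda> \<gamma>)" for \<gamma>
  have [measurable]: "X \<in> borel_measurable \<Gamma>" "S \<in> borel_measurable \<Gamma>" "I \<in> borel_measurable \<Gamma>"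
    using bounded unfolding X_def[abs_def] S_def[abs_def] I_def[abs_def] by measurable
  have N_eq: "point_count \<Lambda> \<gamma> = ennreal (X \<gamma>)" if "\<gamma> \<in> configs" for \<gamma>
    using that bounded by (simp add: X_def point_count_eq_card)
  have S_eq: "damped_count \<Lambda> \<gamma> = ennreal (S \<gamma>)" and S_le: "S \<gamma> \<le> X \<gamma>" if "\<gamma> \<in> configs" for \<gamma>
  proof -
    have le: "damped_count \<Lambda> \<gamma> \<le> ennreal (X \<gamma>)" using damped_count_le[of \<Lambda> \<gamma>] N_eq[OF that] by simp
    then show *: "damped_count \<Lambda> \<gamma> = ennreal (S \<gamma>)"
      using le_less_trans[OF le ennreal_less_top] by (simp add: S_def)
    show "S \<gamma> \<le> X \<gamma>" using le unfolding * by (simp add: X_def)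
  qed
  have I_eq: "damped_compensator \<Lambda> \<gamma> = ennreal (I \<gamma>)" and I_le: "I \<gamma> \<le> v" for \<gamma>
  proof -
    have le: "damped_compensator \<Lambda> \<gamma> \<le> ennreal v" using damped_compensator_le[OF \<Lambda>] by (simp add: emv)
    then show *: "damped_compensator \<Lambda> \<gamma> = ennreal (I \<gamma>)"
      using le_less_trans[OF le ennreal_less_top] by (simp add: I_def)
    show "I \<gamma> \<le> v" using le v unfolding * by simp
  qed
  have nonneg: "0 \<le> X \<gamma>" "0 \<le> S \<gamma>" "0 \<le> I \<gamma>" for \<gamma> by (simp_all add: X_def S_def I_def)
  have iX: "integrable \<Gamma> (\<lambda>\<gamma>. (X \<gamma>)\<^sup>2)" using X2 by (simp add: X_def)
  have iS: "integrable \<Gamma> (\<lambda>\<gamma>. (S \<gamma>)\<^sup>2)"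
  proof (rule Bochner_Integration.integrable_bound[OF iX])
    show "AE \<gamma> in \<Gamma>. norm ((S \<gamma>)\<^sup>2) \<le> norm ((X \<gamma>)\<^sup>2)"
      using S_le nonneg by (intro AE_I2) (simp add: space_\<Gamma> power_mono)
  qed measurable
  have iI: "integrable \<Gamma> (\<lambda>\<gamma>. (I \<gamma>)\<^sup>2)"
    by (rule integrable_const_bound[of _ "v\<^sup>2"]) (use I_le nonneg in \<open>auto intro!: power_mono\<close>)
  note squares = iX iS iI
  have product: "(\<integral>\<^sup>+\<gamma>. ennreal (F \<gamma>) * ennreal (G \<gamma>) \<partial>\<Gamma>) = ennreal (expectation (\<lambda>\<gamma>. F \<gamma> * G \<gamma>))"
    if "F \<in> {X, S, I, \<lambda>_. 1}" "G \<in> {X, S, I, \<lambda>_. 1}" for F G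
  proof -
    have "F \<in> borel_measurable \<Gamma>" "G \<in> borel_measurable \<Gamma>" "integrable \<Gamma> (\<lambda>\<gamma>. (F \<gamma>)\<^sup>2)"
      "integrable \<Gamma> (\<lambda>\<gamma>. (G \<gamma>)\<^sup>2)" using that squares by auto
    then have "integrable \<Gamma> (\<lambda>\<gamma>. F \<gamma> * G \<gamma>)" by (rule integrable_mult_of_squares)
    moreover have "0 \<le> F \<gamma>" "0 \<le> G \<gamma>" for \<gamma> using that nonneg by auto
    ultimately show ?thesis
      by (subst nn_integral_eq_integral[symmetric]) (auto simp: ennreal_mult)
  qed
  have int: "integrable \<Gamma> (\<lambda>\<gamma>. F \<gamma> * G \<gamma>)" if "F \<in> {X, S, I}" "G \<in> {X, S, I}" for F G
    using that squares by (intro integrable_mult_of_squares) auto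
  have int1: "integrable \<Gamma> X" "integrable \<Gamma> S" "integrable \<Gamma> I"
    using squares by (auto intro: square_integrable_imp_integrable)
  have E: "0 \<le> expectation (\<lambda>\<gamma>. F \<gamma> * G \<gamma>)" if "F \<in> {X, S, I}" "G \<in> {X, S, I}" for F G
    using that nonneg by (intro Bochner_Integration.integral_nonneg) auto
  have cong: "(\<integral>\<^sup>+\<gamma>. f \<gamma> \<partial>\<Gamma>) = (\<integral>\<^sup>+\<gamma>. g \<gamma> \<partial>\<Gamma>)" if "\<And>\<gamma>. \<gamma> \<in> configs \<Longrightarrow> f \<gamma> = g \<gamma>" for f g :: "_ \<Rightarrow> ennreal"
    using that by (intro nn_integral_cong) (simp add: space_\<Gamma>)
  have mean: "expectation S = expectation I"
  proof -
    have "(\<integral>\<^sup>+\<gamma>. ennreal (S \<gamma>) \<partial>\<Gamma>) = (\<integral>\<^sup>+\<gamma>. ennreal (I \<gamma>) \<partial>\<Gamma>)"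
      using expected_damped_count[OF \<Lambda>] by (simp add: I_eq S_eq cong: cong)
    then have "ennreal (expectation S) = ennreal (expectation I)"
      using product[of S "\<lambda>_. 1"] product[of I "\<lambda>_. 1"] by simp
    then show ?thesis using nonneg by (simp add: Bochner_Integration.integral_nonneg)
  qed
  have correlation: "expectation (\<lambda>\<gamma>. S \<gamma> * X \<gamma>) = expectation (\<lambda>\<gamma>. I \<gamma> * X \<gamma>) + c * v"
  proof -
    have "(\<integral>\<^sup>+\<gamma>. ennreal (S \<gamma>) * ennreal (X \<gamma>) \<partial>\<Gamma>)
        = (\<integral>\<^sup>+\<gamma>. ennreal (I \<gamma>) * ennreal (X \<gamma>) \<partial>\<Gamma>) + ennreal c * ennreal v"
      using expected_damped_count_times_count[OF \<Lambda>] by (simp add: I_eq S_eq N_eq c(1) emv cong: cong)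
    then have "ennreal (expectation (\<lambda>\<gamma>. S \<gamma> * X \<gamma>)) = ennreal (expectation (\<lambda>\<gamma>. I \<gamma> * X \<gamma>) + c * v)"
      using E[of I X] c v by (simp add: product ennreal_mult ennreal_plus)
    then show ?thesis using E[of I X] E[of S X] c v by (subst (asm) ennreal_inj) auto
  qed
  have second: "expectation (\<lambda>\<gamma>. S \<gamma> * S \<gamma>) + expectation (\<lambda>\<gamma>. I \<gamma> * I \<gamma>)
      \<le> 2 * expectation (\<lambda>\<gamma>. S \<gamma> * I \<gamma>) + D * v"
  proof -
    have two: "(2::ennreal) = ennreal 2" by simp
    have "(\<integral>\<^sup>+\<gamma>. ennreal (S \<gamma>) * ennreal (S \<gamma>) \<partial>\<Gamma>) + (\<integral>\<^sup>+\<gamma>. ennreal (I \<gamma>) * ennreal (I \<gamma>) \<partial>\<Gamma>)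
        \<le> 2 * (\<integral>\<^sup>+\<gamma>. ennreal (S \<gamma>) * ennreal (I \<gamma>) \<partial>\<Gamma>) + ennreal D * ennreal v"
      using second_moment_bound[OF \<Lambda>] by (simp add: I_eq S_eq D emv cong: cong)
    then have "ennreal (expectation (\<lambda>\<gamma>. S \<gamma> * S \<gamma>) + expectation (\<lambda>\<gamma>. I \<gamma> * I \<gamma>))
        \<le> ennreal (2 * expectation (\<lambda>\<gamma>. S \<gamma> * I \<gamma>) + D * v)"
      using E[of S S] E[of I I] E[of S I] D1 v unfolding two
      by (simp add: product ennreal_mult ennreal_plus del: ennreal_numeral)
    then show ?thesis
      using E[of S I] D1 v by (subst (asm) ennreal_le_iff) auto
  qed
  define Y where "Y \<gamma> = S \<gamma> - I \<gamma>" for \<gamma>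
  have [measurable]: "Y \<in> borel_measurable \<Gamma>" unfolding Y_def[abs_def] by measurable
  have Y2_eq: "(\<lambda>\<gamma>. (Y \<gamma>)\<^sup>2) = (\<lambda>\<gamma>. S \<gamma> * S \<gamma> + I \<gamma> * I \<gamma> - 2 * (S \<gamma> * I \<gamma>))"
    by (auto simp: Y_def power2_eq_square algebra_simps)
  have Y2: "expectation (\<lambda>\<gamma>. (Y \<gamma>)\<^sup>2) \<le> D * v" and iY2: "integrable \<Gamma> (\<lambda>\<gamma>. (Y \<gamma>)\<^sup>2)"
    unfolding Y2_eq using second by (simp_all add: int)
  have XY: "expectation (\<lambda>\<gamma>. X \<gamma> * Y \<gamma>) = c * v"
    unfolding Y_def using correlation int[of S X] int[of I X] by (simp add: right_diff_distrib mult.commute)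
  have Y0: "expectation Y = 0" unfolding Y_def[abs_def] using mean int1 by simp
  have "(c * v)\<^sup>2 / (D * v) \<le> variance X"
    using variance_ge_of_correlation[OF _ _ iX iY2 Y0 Y2] D1 v unfolding XY by simp
  also have "(c * v)\<^sup>2 / (D * v) = c\<^sup>2 / D * v"
    using v D1 by (simp add: power2_eq_square field_simps)
  finally show ?thesis unfolding X_def c_def D_def v_def .
qed

lemma count_variance_finite_imp:
  assumes \<Lambda> [measurable]: "\<Lambda> \<in> sets borel" and bounded: "bounded \<Lambda>"
    and v_pos: "0 < emeasure lborel \<Lambda>"
    and less: "count_variance \<Gamma> \<Lambda> / emeasure lborel \<Lambda> < \<infinity>"
  shows "integrable \<Gamma> (\<lambda>\<gamma>. real (card (\<gamma> \<inter> \<Lambda>)) ^ 2)" and "mean_intensity < \<infinity>"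
proof -
  show *: "integrable \<Gamma> (\<lambda>\<gamma>. real (card (\<gamma> \<inter> \<Lambda>)) ^ 2)"
  proof (rule ccontr)
    assume "\<not> ?thesis"
    then have "count_variance \<Gamma> \<Lambda> = top" by (simp add: count_variance_def)
    moreover have "emeasure lborel \<Lambda> \<noteq> top"
      using emeasure_bounded_finite[OF bounded] by (metis infinity_ennreal_def less_irrefl)
    ultimately have "count_variance \<Gamma> \<Lambda> / emeasure lborel \<Lambda> = top"
      by (simp add: ennreal_top_divide)
    then show False using less by simp
  qed
  have "integrable \<Gamma> (\<lambda>\<gamma>. real (card (\<gamma> \<inter> \<Lambda>)))"
    by (rule square_integrable_imp_integrable[OF measurable_card[OF \<Lambda> bounded] *])
  then have "(\<integral>\<^sup>+\<gamma>. ennreal (real (card (\<gamma> \<inter> \<Lambda>))) \<partial>\<Gamma>) < \<infinity>"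
    by (subst nn_integral_eq_integral) auto
  also have "(\<integral>\<^sup>+\<gamma>. ennreal (real (card (\<gamma> \<inter> \<Lambda>))) \<partial>\<Gamma>) = mean_intensity * emeasure lborel \<Lambda>"
    unfolding expected_count[OF \<Lambda>, symmetric]
    using bounded by (intro nn_integral_cong) (simp add: space_\<Gamma> point_count_eq_card)
  finally show "mean_intensity < \<infinity>"
    using v_pos by (auto simp: ennreal_mult_less_top)
qed

text \<open>Balls already contradict hyperuniformity. Convergence to 0 is used twice: once to obtain a finite
  density, on which the constant \<open>q\<close> depends, and then for a ratio below \<open>q\<close>.\<close>

theorem not_hyperuniform:
  assumes "interaction_strength < \<infinity>" and "L 0 {} \<noteq> 0"
  shows "\<not> hyperuniform \<Gamma>"
proof
  assume hyp: "hyperuniform \<Gamma>"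
  define \<Lambda> :: "nat \<Rightarrow> 'a set" where "\<Lambda> n = ball 0 (real n + 1)" for n
  have \<Lambda>: "\<Lambda> n \<in> sets borel" "bounded (\<Lambda> n)" for n by (simp_all add: \<Lambda>_def)
  have "incseq \<Lambda>" by (auto simp: \<Lambda>_def incseq_def intro!: subset_ball)
  moreover have "(\<Union>n. \<Lambda> n) = UNIV"
  proof -
    have "\<exists>n. x \<in> \<Lambda> n" for x
    proof -
      obtain n where "norm x < real n" using reals_Archimedean2 by blast
      then show ?thesis by (auto simp: \<Lambda>_def intro!: exI[of _ n])
    qed
    then show ?thesis by auto
  qed
  ultimately have lim: "(\<lambda>n. count_variance \<Gamma> (\<Lambda> n) / emeasure lborel (\<Lambda> n)) \<longlonglongrightarrow> 0"
    using hyp \<Lambda> by (simp add: hyperuniform_def)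
  have v: "0 < measure lborel (\<Lambda> n)" for n
    by (simp add: \<Lambda>_def content_ball_pos)
  have ev: "emeasure lborel (\<Lambda> n) = ennreal (measure lborel (\<Lambda> n))" for n
    using emeasure_bounded_finite[OF \<Lambda>(2)] by (intro emeasure_eq_ennreal_measure) (simp add: less_top)
  have ev_pos: "0 < emeasure lborel (\<Lambda> n)" for n using v by (simp add: ev)
  obtain k where "count_variance \<Gamma> (\<Lambda> k) / emeasure lborel (\<Lambda> k) < \<infinity>"
    using eventually_happens[OF order_tendstoD(2)[OF lim, of \<infinity>]] by auto
  then have \<rho>: "mean_intensity < \<infinity>"
    by (rule count_variance_finite_imp(2)[OF \<Lambda> ev_pos])
  define q where "q = (enn2real mean_damped_intensity)\<^sup>2 / enn2real (1 + interaction_strength * (2 + mean_intensity))"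
  have "0 < enn2real mean_damped_intensity"
    using mean_damped_intensity_pos[OF \<rho> assms(2)] le_less_trans[OF mean_damped_intensity_le_1 ennreal_one_less_top]
    by (simp add: enn2real_positive_iff)
  moreover have "0 < enn2real (1 + interaction_strength * (2 + mean_intensity))"
    using assms(1) \<rho> by (simp add: enn2real_positive_iff ennreal_mult_less_top add_pos_nonneg)
  ultimately have q: "0 < q" by (simp add: q_def)
  then obtain n where n: "count_variance \<Gamma> (\<Lambda> n) / emeasure lborel (\<Lambda> n) < ennreal q"
    using eventually_happens[OF order_tendstoD(2)[OF lim, of "ennreal q"]] by auto
  then have X2: "integrable \<Gamma> (\<lambda>\<gamma>. real (card (\<gamma> \<inter> \<Lambda> n)) ^ 2)"
    using count_variance_finite_imp(1)[OF \<Lambda> ev_pos less_trans[OF n]] by simp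
  have "q * measure lborel (\<Lambda> n) \<le> variance (\<lambda>\<gamma>. real (card (\<gamma> \<inter> \<Lambda> n)))"
    unfolding q_def by (rule variance_lower_bound[OF \<Lambda> v X2 assms(1) \<rho>])
  then have "q \<le> variance (\<lambda>\<gamma>. real (card (\<gamma> \<inter> \<Lambda> n))) / measure lborel (\<Lambda> n)"
    using v by (simp add: pos_le_divide_eq)
  then have "ennreal q \<le> count_variance \<Gamma> (\<Lambda> n) / emeasure lborel (\<Lambda> n)"
    using X2 v[of n] by (simp add: count_variance_def ev divide_ennreal variance_positive)
  with n show False by simp
qed

end

section \<open>Pair potentials\<close>

text \<open>For \<open>\<beta> > 0\<close> this includes \<open>u = -\<infinity>\<close> and \<open>v = \<infinity>\<close>, where both sides are 0 since \<open>-\<infinity> + \<infinity> = \<infinity>\<close> for extended reals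
  and \<open>\<infinity> * 0 = 0\<close>.\<close>

lemma exp_ereal_energy_add:
  assumes "0 \<le> \<beta>" "v \<noteq> -\<infinity>"
  shows "exp_ereal (- (ereal \<beta> * (u + v)))
    = exp_ereal (- (ereal \<beta> * u)) * ennreal (enn2real (exp_ereal (- (ereal \<beta> * v))))"
  using assms
  by (cases u; cases v; cases "\<beta> = 0")
     (auto simp: exp_ereal_def ennreal_mult[symmetric] exp_add[symmetric] algebra_simps ennreal_top_mult)

lemma measurable_exp_ereal [measurable]: "exp_ereal \<in> borel_measurable borel"
  unfolding exp_ereal_def[abs_def] by measurable

text \<open>The identity extends to undefined energies: \<open>\<infinity> - \<infinity> = \<infinity>\<close> for extended reals, and adding a value
  other than \<open>-\<infinity>\<close> leaves this unchanged.\<close>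

lemma local_energy_insert:
  assumes "\<Phi> (y - x) \<noteq> -\<infinity>" "x \<notin> \<gamma>"
  shows "local_energy \<Phi> y (insert x \<gamma>) = local_energy \<Phi> y \<gamma> + \<Phi> (y - x)"
proof -
  have ins: "pos_energy \<Phi> y (insert x \<gamma>) = e2ennreal (\<Phi> (y - x)) + pos_energy \<Phi> y \<gamma>"
    "neg_energy \<Phi> y (insert x \<gamma>) = e2ennreal (- \<Phi> (y - x)) + neg_energy \<Phi> y \<gamma>"
    using assms(2) by (simp_all add: pos_energy_def neg_energy_def count_integral_insert)
  show ?thesis
  proof (cases "\<Phi> (y - x)")
    case (real r)
    then show ?thesis
      unfolding local_energy_def ins
      by (cases "pos_energy \<Phi> y \<gamma>"; cases "neg_energy \<Phi> y \<gamma>"; cases "0 \<le> r")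
         (auto simp: plus_ennreal.rep_eq enn2ereal_e2ennreal e2ennreal_neg enn2ereal_ennreal ennreal_neg zero_ennreal.rep_eq)
  next
    case PInf
    then show ?thesis
      unfolding local_energy_def ins
      by (cases "neg_energy \<Phi> y \<gamma>") (auto simp: plus_ennreal.rep_eq enn2ereal_e2ennreal e2ennreal_neg)
  qed (use assms in simp)
qed

lemma local_energy_translate:
  "local_energy \<Phi> (v + x) ((+) v ` \<gamma>) = local_energy \<Phi> x \<gamma>"
  by (simp add: local_energy_def pos_energy_def neg_energy_def count_integral_translate)

lemma measurable_pair_papangelou:
  fixes \<Phi> :: "'a::euclidean_space \<Rightarrow> ereal"
  assumes [measurable]: "\<Phi> \<in> borel_measurable borel"
  shows "(\<lambda>(x, \<gamma>). pair_papangelou z \<beta> \<Phi> x \<gamma>) \<in> borel_measurable (borel \<Otimes>\<^sub>M config_space)"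
proof -
  have [measurable]: "(\<lambda>w. pos_energy \<Phi> (fst w) (snd w)) \<in> borel_measurable (borel \<Otimes>\<^sub>M config_space)"
    "(\<lambda>w. neg_energy \<Phi> (fst w) (snd w)) \<in> borel_measurable (borel \<Otimes>\<^sub>M config_space)"
    unfolding pos_energy_def neg_energy_def by measurable
  show ?thesis
    unfolding pair_papangelou_def local_energy_def split_beta' by measurable
qed

lemma pair_gibbs_interaction:
  fixes \<Phi> :: "'a::euclidean_space \<Rightarrow> ereal"
  assumes \<beta>: "\<beta> \<ge> 0" and \<Phi>: "pair_potential \<Phi>" and "stationary \<Gamma>" and G: "pair_gibbs z \<beta> \<Phi> \<Gamma>"
  shows "pair_interaction_gibbs \<Gamma> (pair_papangelou z \<beta> \<Phi>) (\<lambda>y. enn2real (exp_ereal (- (ereal \<beta> * \<Phi> y))))"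
proof -
  have [measurable]: "\<Phi> \<in> borel_measurable borel" and finite: "\<Phi> x \<noteq> -\<infinity>" and sym: "\<Phi> (- x) = \<Phi> x" for x
    using \<Phi> by (auto simp: pair_potential_def)
  have G: "prob_space \<Gamma>" "sets \<Gamma> = sets config_space" "has_papangelou_intensity \<Gamma> (pair_papangelou z \<beta> \<Phi>)"
    using G by (auto simp: pair_gibbs_def point_process_def)
  have insert: "pair_papangelou z \<beta> \<Phi> y (insert x \<gamma>)
      = pair_papangelou z \<beta> \<Phi> y \<gamma> * ennreal (enn2real (exp_ereal (- (ereal \<beta> * \<Phi> (y - x)))))"
    if "x \<notin> \<gamma>" for x y \<gamma>
    unfolding pair_papangelou_def local_energy_insert[where \<Phi> = \<Phi>, OF finite that]
      exp_ereal_energy_add[OF \<beta> finite] by (simp add: mult.assoc)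
  have translate: "pair_papangelou z \<beta> \<Phi> (v + x) ((+) v ` \<gamma>) = pair_papangelou z \<beta> \<Phi> x \<gamma>" for v x \<gamma>
    by (simp add: pair_papangelou_def local_energy_translate)
  show ?thesis
    unfolding pair_interaction_gibbs_def pair_interaction_gibbs_axioms_def
    using G assms(3) measurable_pair_papangelou[of \<Phi> z \<beta>]
    by (auto simp: insert sym translate)
qed

theorem corollary3:
  fixes z \<beta> :: real
    and \<Phi> :: "'a::euclidean_space \<Rightarrow> ereal"
    and \<Gamma> :: "'a set measure"
  assumes "z > 0" and "\<beta> \<ge> 0"
    and "pair_potential \<Phi>"
    and "superstable \<Phi>"
    and "lower_regular \<Phi>"
    and "integrable_potential \<beta> \<Phi>"
    and "stationary \<Gamma>"
    and "pair_gibbs z \<beta> \<Phi> \<Gamma>"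
  shows "\<not> hyperuniform \<Gamma>"
proof -
  interpret pair_interaction_gibbs \<Gamma> "pair_papangelou z \<beta> \<Phi>" "\<lambda>y. enn2real (exp_ereal (- (ereal \<beta> * \<Phi> y)))"
    using assms by (intro pair_gibbs_interaction)
  have "interaction_strength < \<infinity>"
    using assms(6) unfolding integrable_potential_def interaction_strength_def
    by (subst nn_integral_eq_integral) auto
  moreover have "pair_papangelou z \<beta> \<Phi> 0 {} \<noteq> 0"
    using assms(1)
    by (simp add: pair_papangelou_def local_energy_def pos_energy_def neg_energy_def exp_ereal_def
        zero_ereal_def[symmetric] nn_integral_count_space_finite zero_ennreal.rep_eq)
  ultimately show ?thesis by (rule not_hyperuniform)
qed

end
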